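(* Let $\Phi:\mathcal{L}(\mathcal{H})\to\mathcal{L}(\mathcal{K})$ be a quantum channel and let $\mathscr{A}$ be a nonzero $C^*$-algebra. Then the following are equivalent: (i) $\Phi$ admits a dominating transmittable algebra $\mathscr{A}_{\mathrm{dom}}(\Phi)$, and $\mathscr{A}_{\mathrm{dom}}(\Phi)\cong\mathscr{A}$; (ii) $\mathscr{A}\in\mathscr{T}(\Phi)$ and $\mathfrak{F}(\mathscr{A})\cap\mathscr{T}(\Phi)=\varnothing$.
   Context: All Hilbert spaces are finite-dimensional and complex; all $C^*$-algebras are finite-dimensional. $\mathcal{L}(\mathcal{H})$ is the algebra of linear operators on $\mathcal{H}$. A quantum channel is a linear, completely positive, trace-preserving map $\Phi:\mathcal{L}(\mathcal{H})\to\mathcal{L}(\mathcal{K})$; its adjoint $\Phi^*$ is defined by $\mathrm{Tr}(Y\Phi(X))=\mathrm{Tr}(\Phi^*(Y)X)$. $\cong$ denotes $*$-isomorphism. Embedding: $\mathscr{A}\leq\mathscr{B}$ means there is an injective (not necessarily unital) $*$-homomorphism $\mathscr{A}\to\mathscr{B}$; $\mathscr{A}<\mathscr{B}$ means $\mathscr{A}\leq\mathscr{B}$ and $\mathscr{A}\not\cong\mathscr{B}$. Forbidden types: $\mathfrak{F}(\mathscr{A})$ is the set (up to $*$-isomorphism) of minimal elements, with respect to $\leq$, of the collection of nonzero finite-dimensional $C^*$-algebras that do not embed into $\mathscr{A}$; i.e. $\mathscr{B}\in\mathfrak{F}(\mathscr{A})$ iff $\mathscr{B}\not\leq\mathscr{A}$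 but every nonzero $\mathscr{C}<\mathscr{B}$ satisfies $\mathscr{C}\leq\mathscr{A}$. Correctability: a $*$-subalgebra $\mathscr{A}\subseteq\mathcal{L}(\mathcal{H})$ with unit projection $P$ (possibly $P\neq 1_{\mathcal{H}}$) is correctable for $\Phi$ if, with $C=P\mathcal{H}$, $V:C\to\mathcal{H}$ the inclusion and $\Phi|_C(Y)=\Phi(VYV^* )$, there is a channel $\mathcal{D}:\mathcal{L}(\mathcal{K})\to\mathcal{L}(C)$ with $(\mathcal{D}\circ\Phi|_C)^*(X)=X$ for all $X\in V^*\mathscr{A}V$. $\mathscr{A}$ is transmittable via $\Phi$ if there is an injective $*$-homomorphism $\pi:\mathscr{A}\to\mathcal{L}(\mathcal{H})$ whose image is correctable for $\Phi$; $\mathscr{T}(\Phi)$ is the set of nonzero transmittable algebras up to $*$-isomorphism. A dominating transmittable algebra $\mathscr{A}_{\mathrm{dom}}(\Phi)$ is an element of $\mathscr{T}(\Phi)$ into which every element of $\mathscr{T}(\Phi)$ embeds (unique up to $*$-isomorphism if it exists). *)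

theory Defs
  imports
    "Jordan_Normal_Form.VS_Connect"
    "Jordan_Normal_Form.Schur_Decomposition"
    "HOL-Library.Complex_Order"
begin

section \<open>Finite-dimensional C*-algebras\<close>

text \<open>
  The field \<open>one\<close>, inherited from the ring record, plays no role: algebras are not equipped with a
  unit (nothing below refers to it), and homomorphisms need not preserve units.
\<close>

record 'a cstar = "(complex, 'a) module" +
  star :: "'a \<Rightarrow> 'a"
  cnorm :: "'a \<Rightarrow> real"

text \<open>Completeness of the norm is automatic in finite dimension.\<close>

locale fd_cstar_algebra = vectorspace "class_ring :: complex ring" A
  for A :: "'a cstar" (structure) +
  assumes finite_dimensional: "fin_dim"
    and alg_mult_closed: "\<lbrakk>x \<in> carrier A; y \<in> carrier A\<rbrakk> \<Longrightarrow> x \<otimes> y \<in> carrier A"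
    and alg_mult_assoc: "\<lbrakk>x \<in> carrier A; y \<in> carrier A; z \<in> carrier A\<rbrakk> \<Longrightarrow>
      (x \<otimes> y) \<otimes> z = x \<otimes> (y \<otimes> z)"
    and alg_l_distr: "\<lbrakk>x \<in> carrier A; y \<in> carrier A; z \<in> carrier A\<rbrakk> \<Longrightarrow>
      (x \<oplus> y) \<otimes> z = (x \<otimes> z) \<oplus> (y \<otimes> z)"
    and alg_r_distr: "\<lbrakk>x \<in> carrier A; y \<in> carrier A; z \<in> carrier A\<rbrakk> \<Longrightarrow>
      z \<otimes> (x \<oplus> y) = (z \<otimes> x) \<oplus> (z \<otimes> y)"
    and alg_smult_l: "\<lbrakk>x \<in> carrier A; y \<in> carrier A\<rbrakk> \<Longrightarrow> (c \<odot> x) \<otimes> y = c \<odot> (x \<otimes> y)"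
    and alg_smult_r: "\<lbrakk>x \<in> carrier A; y \<in> carrier A\<rbrakk> \<Longrightarrow> x \<otimes> (c \<odot> y) = c \<odot> (x \<otimes> y)"
    and star_closed: "x \<in> carrier A \<Longrightarrow> star A x \<in> carrier A"
    and star_star: "x \<in> carrier A \<Longrightarrow> star A (star A x) = x"
    and star_add: "\<lbrakk>x \<in> carrier A; y \<in> carrier A\<rbrakk> \<Longrightarrow> star A (x \<oplus> y) = star A x \<oplus> star A y"
    and star_smult: "x \<in> carrier A \<Longrightarrow> star A (c \<odot> x) = cnj c \<odot> star A x"
    and star_mult: "\<lbrakk>x \<in> carrier A; y \<in> carrier A\<rbrakk> \<Longrightarrow> star A (x \<otimes> y) = star A y \<otimes> star A x"
    and cnorm_nonneg: "x \<in> carrier A \<Longrightarrow> 0 \<le> cnorm A x"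
    and cnorm_eq_0_iff: "x \<in> carrier A \<Longrightarrow> cnorm A x = 0 \<longleftrightarrow> x = \<zero>"
    and cnorm_triangle: "\<lbrakk>x \<in> carrier A; y \<in> carrier A\<rbrakk> \<Longrightarrow>
      cnorm A (x \<oplus> y) \<le> cnorm A x + cnorm A y"
    and cnorm_smult: "x \<in> carrier A \<Longrightarrow> cnorm A (c \<odot> x) = cmod c * cnorm A x"
    and cnorm_mult: "\<lbrakk>x \<in> carrier A; y \<in> carrier A\<rbrakk> \<Longrightarrow>
      cnorm A (x \<otimes> y) \<le> cnorm A x * cnorm A y"
    and cstar_identity: "x \<in> carrier A \<Longrightarrow> cnorm A (star A x \<otimes> x) = (cnorm A x)\<^sup>2"

definition nonzero_alg :: "'a cstar \<Rightarrow> bool" where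
  "nonzero_alg A \<longleftrightarrow> carrier A \<noteq> {\<zero>\<^bsub>A\<^esub>}"

definition star_hom :: "'a cstar \<Rightarrow> 'b cstar \<Rightarrow> ('a \<Rightarrow> 'b) set" where
  "star_hom A B = {\<pi> \<in> LinearCombinations.module_hom (class_ring :: complex ring) A B.
     (\<forall>x \<in> carrier A. \<forall>y \<in> carrier A. \<pi> (x \<otimes>\<^bsub>A\<^esub> y) = \<pi> x \<otimes>\<^bsub>B\<^esub> \<pi> y) \<and>
     (\<forall>x \<in> carrier A. \<pi> (star A x) = star B (\<pi> x))}"

definition star_isomorphic :: "'a cstar \<Rightarrow> 'b cstar \<Rightarrow> bool" where
  "star_isomorphic A B \<longleftrightarrow> (\<exists>\<pi> \<in> star_hom A B. bij_betw \<pi> (carrier A) (carrier B))"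

definition embeds :: "'a cstar \<Rightarrow> 'b cstar \<Rightarrow> bool" where
  "embeds A B \<longleftrightarrow> (\<exists>\<pi> \<in> star_hom A B. inj_on \<pi> (carrier A))"

definition strictly_embeds :: "'a cstar \<Rightarrow> 'b cstar \<Rightarrow> bool" where
  "strictly_embeds A B \<longleftrightarrow> embeds A B \<and> \<not> star_isomorphic A B"

text \<open>
  HOL cannot quantify over all carrier types, so a collection of algebras up to *-isomorphism is
  represented by an isomorphism-closed set of algebras whose carriers are sets of complex matrices
  (with arbitrary operations). Every finite-dimensional C*-algebra has an isomorphic copy of this
  form: its carrier has at most the cardinality of the continuum.
\<close>

definition forbidden_types :: "'a cstar \<Rightarrow> complex mat cstar set" where
  "forbidden_types A = {B. fd_cstar_algebra B \<and> nonzero_alg B \<and> \<not> embeds B A \<and>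
     (\<forall>C :: complex mat cstar.
        fd_cstar_algebra C \<and> nonzero_alg C \<and> strictly_embeds C B \<longrightarrow> embeds C A)}"


section \<open>Operators on finite-dimensional Hilbert spaces\<close>

text \<open>
  A finite-dimensional Hilbert space is coordinatised by an orthonormal basis as the space of
  complex vectors of length \<open>n\<close>, and its operators are the complex \<open>n \<times> n\<close> matrices.
\<close>

definition vec_norm2 :: "complex vec \<Rightarrow> real" where
  "vec_norm2 v = sqrt (Re (v \<bullet>c v))"

definition op_norm :: "complex mat \<Rightarrow> real" where
  "op_norm X = (SUP v \<in> {v \<in> carrier_vec (dim_col X). vec_norm2 v \<le> 1}. vec_norm2 (X *\<^sub>v v))"

definition op_algebra :: "nat \<Rightarrow> complex mat cstar" where
  "op_algebra n = module.extend (module_mat TYPE(complex) n n)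
     \<lparr>star = mat_adjoint, cnorm = op_norm\<rparr>"

definition mat_trace :: "complex mat \<Rightarrow> complex" where
  "mat_trace X = (\<Sum>i < dim_row X. X $$ (i, i))"

definition pos_semidef :: "nat \<Rightarrow> complex mat \<Rightarrow> bool" where
  "pos_semidef n X \<longleftrightarrow> X \<in> carrier_mat n n \<and> (\<forall>v \<in> carrier_vec n. 0 \<le> (X *\<^sub>v v) \<bullet>c v)"

text \<open>
  The map \<open>id \<otimes> \<Phi>\<close>, where \<open>id\<close> is the identity on \<open>k \<times> k\<close> matrices: a matrix of size \<open>k * n\<close>
  is a \<open>k \<times> k\<close> array of \<open>n \<times> n\<close> blocks, and \<open>\<Phi>\<close> is applied to each block.
\<close>

definition mat_block :: "nat \<Rightarrow> complex mat \<Rightarrow> nat \<Rightarrow> nat \<Rightarrow> complex mat" where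
  "mat_block n X a b = mat n n (\<lambda>(i, j). X $$ (a * n + i, b * n + j))"

definition ampliation ::
    "nat \<Rightarrow> nat \<Rightarrow> nat \<Rightarrow> (complex mat \<Rightarrow> complex mat) \<Rightarrow> complex mat \<Rightarrow> complex mat" where
  "ampliation k n m \<Phi> X = mat (k * m) (k * m)
     (\<lambda>(r, s). \<Phi> (mat_block n X (r div m) (s div m)) $$ (r mod m, s mod m))"

definition completely_positive :: "nat \<Rightarrow> nat \<Rightarrow> (complex mat \<Rightarrow> complex mat) \<Rightarrow> bool" where
  "completely_positive n m \<Phi> \<longleftrightarrow>
     (\<forall>k X. pos_semidef (k * n) X \<longrightarrow> pos_semidef (k * m) (ampliation k n m \<Phi> X))"

text \<open>Maps between operator algebras are only constrained on \<open>n \<times> n\<close> matrices.\<close>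

definition quantum_channel :: "nat \<Rightarrow> nat \<Rightarrow> (complex mat \<Rightarrow> complex mat) \<Rightarrow> bool" where
  "quantum_channel n m \<Phi> \<longleftrightarrow>
     \<Phi> \<in> LinearCombinations.module_hom (class_ring :: complex ring) (op_algebra n) (op_algebra m) \<and>
     completely_positive n m \<Phi> \<and>
     (\<forall>X \<in> carrier_mat n n. mat_trace (\<Phi> X) = mat_trace X)"

text \<open>Existence and uniqueness hold for every linear \<open>\<Phi>\<close>, as the trace form is nondegenerate.\<close>

definition map_adjoint ::
    "nat \<Rightarrow> nat \<Rightarrow> (complex mat \<Rightarrow> complex mat) \<Rightarrow> complex mat \<Rightarrow> complex mat" where
  "map_adjoint n m \<Phi> Y = (THE Z. Z \<in> carrier_mat n n \<and>
     (\<forall>X \<in> carrier_mat n n. mat_trace (Y * \<Phi> X) = mat_trace (Z * X)))"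


section \<open>Correctable and transmittable algebras\<close>

definition star_subalgebra :: "nat \<Rightarrow> complex mat set \<Rightarrow> bool" where
  "star_subalgebra n S \<longleftrightarrow> LinearCombinations.submodule (class_ring :: complex ring) S (op_algebra n) \<and>
     (\<forall>X \<in> S. \<forall>Y \<in> S. X * Y \<in> S) \<and> (\<forall>X \<in> S. mat_adjoint X \<in> S)"

definition unit_projection :: "nat \<Rightarrow> complex mat set \<Rightarrow> complex mat \<Rightarrow> bool" where
  "unit_projection n S P \<longleftrightarrow> P \<in> S \<and> P * P = P \<and> mat_adjoint P = P \<and>
     (\<forall>X \<in> S. P * X = X \<and> X * P = X)"

text \<open>
  The range \<open>C\<close> of \<open>P\<close> is identified with the complex vectors of length \<open>k = dim C\<close> by an
  orthonormal basis of \<open>C\<close>; the inclusion of \<open>C\<close> then becomes an \<open>n \<times> k\<close> matrix \<open>V\<close> with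
  orthonormal columns and \<open>V V* = P\<close>. A different basis changes \<open>V\<close> by a unitary on the right,
  which does not affect the condition.
\<close>

definition subspace_inclusion :: "nat \<Rightarrow> nat \<Rightarrow> complex mat \<Rightarrow> complex mat \<Rightarrow> bool" where
  "subspace_inclusion n k P V \<longleftrightarrow> V \<in> carrier_mat n k \<and>
     mat_adjoint V * V = 1\<^sub>m k \<and> V * mat_adjoint V = P"

definition restrict_map ::
    "complex mat \<Rightarrow> (complex mat \<Rightarrow> complex mat) \<Rightarrow> complex mat \<Rightarrow> complex mat" where
  "restrict_map V \<Phi> Y = \<Phi> (V * Y * mat_adjoint V)"

definition correctable ::
    "nat \<Rightarrow> nat \<Rightarrow> (complex mat \<Rightarrow> complex mat) \<Rightarrow> complex mat set \<Rightarrow> bool" where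
  "correctable n m \<Phi> S \<longleftrightarrow> star_subalgebra n S \<and>
     (\<exists>P k V D. unit_projection n S P \<and> subspace_inclusion n k P V \<and> quantum_channel m k D \<and>
        (\<forall>X \<in> (\<lambda>Y. mat_adjoint V * Y * V) ` S.
           map_adjoint k k (D \<circ> restrict_map V \<Phi>) X = X))"

definition transmittable ::
    "nat \<Rightarrow> nat \<Rightarrow> (complex mat \<Rightarrow> complex mat) \<Rightarrow> 'a cstar \<Rightarrow> bool" where
  "transmittable n m \<Phi> A \<longleftrightarrow>
     (\<exists>\<pi> \<in> star_hom A (op_algebra n). inj_on \<pi> (carrier A) \<and> correctable n m \<Phi> (\<pi> ` carrier A))"

definition transmittable_algebras ::
    "nat \<Rightarrow> nat \<Rightarrow> (complex mat \<Rightarrow> complex mat) \<Rightarrow> 'a cstar set" where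
  "transmittable_algebras n m \<Phi> = {A. fd_cstar_algebra A \<and> nonzero_alg A \<and> transmittable n m \<Phi> A}"

definition dominating_transmittable ::
    "nat \<Rightarrow> nat \<Rightarrow> (complex mat \<Rightarrow> complex mat) \<Rightarrow> complex mat cstar \<Rightarrow> bool" where
  "dominating_transmittable n m \<Phi> D \<longleftrightarrow> D \<in> transmittable_algebras n m \<Phi> \<and>
     (\<forall>B :: complex mat cstar. B \<in> transmittable_algebras n m \<Phi> \<longrightarrow> embeds B D)"

end

theory Submission
  imports Defs
begin

text \<open>
  The nontrivial implication rests on two facts. First, a transmittable \<open>B\<close> that does not embed into
  \<open>A\<close> has, among its nonzero subalgebras that do not embed into \<open>A\<close>, one of least dimension, and this
  one is a forbidden type of \<open>A\<close>. Second, transmittability passes to subalgebras: a *-algebra of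
  matrices has a unit projection, and a decoder for the large algebra, compressed to the range of
  the unit of the small one, is a decoder for the small algebra.
\<close>

section \<open>Homomorphisms and embeddings\<close>

text \<open>From (i) to (ii), everything transmittable embeds into \<open>A\<close>, and a forbidden
  type by definition does not.

  The delicate point is the compression of a decoder by a coisometry \<open>K\<close>: the map
  \<open>Y \<mapsto> K Y K*\<close> loses the trace \<open>tr ((1 - K* K) Y)\<close>. Preparing a
  fixed state with that weight restores the trace, and it must not disturb the decoding. It does
  not, because the weight is the expectation of a projection belonging to the large algebra, which
  the given decoder preserves. A state can only be prepared on a space of positive dimension, and
  this is where nonzero algebras enter.

  The carrier type of \<open>A\<close> is arbitrary, whereas a dominating algebra has matrices as
  elements. For the direction from (ii) to (i), \<open>A\<close> is therefore copied onto the range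
  of a representation, with its norm carried along.\<close>

lemma star_homD:
  assumes "f \<in> star_hom A B"
  shows "x \<in> carrier A \<Longrightarrow> f x \<in> carrier B"
    and "\<lbrakk>x \<in> carrier A; y \<in> carrier A\<rbrakk> \<Longrightarrow> f (x \<oplus>\<^bsub>A\<^esub> y) = f x \<oplus>\<^bsub>B\<^esub> f y"
    and "x \<in> carrier A \<Longrightarrow> f (c \<odot>\<^bsub>A\<^esub> x) = c \<odot>\<^bsub>B\<^esub> f x"
    and "\<lbrakk>x \<in> carrier A; y \<in> carrier A\<rbrakk> \<Longrightarrow> f (x \<otimes>\<^bsub>A\<^esub> y) = f x \<otimes>\<^bsub>B\<^esub> f y"
    and "x \<in> carrier A \<Longrightarrow> f (star A x) = star B (f x)"
  using assms by (auto simp: star_hom_def LinearCombinations.module_hom_def)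

lemma star_homI:
  assumes "\<And>x. x \<in> carrier A \<Longrightarrow> f x \<in> carrier B"
    and "\<And>x y. \<lbrakk>x \<in> carrier A; y \<in> carrier A\<rbrakk> \<Longrightarrow> f (x \<oplus>\<^bsub>A\<^esub> y) = f x \<oplus>\<^bsub>B\<^esub> f y"
    and "\<And>c x. x \<in> carrier A \<Longrightarrow> f (c \<odot>\<^bsub>A\<^esub> x) = c \<odot>\<^bsub>B\<^esub> f x"
    and "\<And>x y. \<lbrakk>x \<in> carrier A; y \<in> carrier A\<rbrakk> \<Longrightarrow> f (x \<otimes>\<^bsub>A\<^esub> y) = f x \<otimes>\<^bsub>B\<^esub> f y"
    and "\<And>x. x \<in> carrier A \<Longrightarrow> f (star A x) = star B (f x)"
  shows "f \<in> star_hom A B"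
  using assms by (auto simp: star_hom_def LinearCombinations.module_hom_def)

lemma star_hom_comp:
  assumes "f \<in> star_hom A B" and "g \<in> star_hom B C"
  shows "g \<circ> f \<in> star_hom A C"
  by (rule star_homI) (simp_all add: star_homD[OF assms(1)] star_homD[OF assms(2)])

lemma embeds_trans:
  assumes "embeds A B" and "embeds B C"
  shows "embeds A C"
proof -
  obtain f g where f: "f \<in> star_hom A B" "inj_on f (carrier A)"
    and g: "g \<in> star_hom B C" "inj_on g (carrier B)"
    using assms unfolding embeds_def by blast
  have "inj_on (g \<circ> f) (carrier A)"
    using f g by (auto intro!: comp_inj_on elim: inj_on_subset simp: star_homD)
  then show ?thesis
    using star_hom_comp[OF f(1) g(1)] unfolding embeds_def by blast
qed

lemma star_isomorphic_embeds: "star_isomorphic A B \<Longrightarrow> embeds A B"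
  unfolding star_isomorphic_def embeds_def by (auto simp: bij_betw_def)

context fd_cstar_algebra
begin

lemma alg_smult_closed: "x \<in> carrier A \<Longrightarrow> c \<odot> x \<in> carrier A"
  by (simp add: smult_closed)

lemma alg_smult_simps:
  assumes "x \<in> carrier A"
  shows "(a + b) \<odot> x = a \<odot> x \<oplus> b \<odot> x"
    and "(a * b) \<odot> x = a \<odot> (b \<odot> x)"
    and "1 \<odot> x = x"
  using assms smult_l_distr[of a b x] smult_assoc1[of a b x] smult_one[of x] by simp_all

lemma embeds_refl: "embeds A A"
  unfolding embeds_def by (rule bexI[of _ "\<lambda>x. x"]) (auto intro!: star_homI)

lemma star_isomorphic_sym:
  assumes "star_isomorphic A B"
  shows "star_isomorphic B A"
proof -
  obtain f where f: "f \<in> star_hom A B" and bij: "bij_betw f (carrier A) (carrier B)"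
    using assms unfolding star_isomorphic_def by blast
  let ?g = "inv_into (carrier A) f"
  have g: "\<exists>x \<in> carrier A. y = f x" if "y \<in> carrier B" for y
    using bij that by (auto simp: bij_betw_def)
  have gf: "?g (f x) = x" if "x \<in> carrier A" for x
    using bij that by (simp add: bij_betw_def)
  have "?g \<in> star_hom B A"
  proof (rule star_homI)
    fix y z c assume "y \<in> carrier B"
    then obtain x where x: "x \<in> carrier A" "y = f x" using g by blast
    then show "?g y \<in> carrier A" by (simp add: gf)
    show "?g (c \<odot>\<^bsub>B\<^esub> y) = c \<odot> ?g y"
      using x by (simp add: gf alg_smult_closed flip: star_homD(3)[OF f])
    show "?g (star B y) = star A (?g y)"
      using x by (simp add: gf star_closed flip: star_homD(5)[OF f])
    assume "z \<in> carrier B"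
    then obtain w where w: "w \<in> carrier A" "z = f w" using g by blast
    show "?g (y \<oplus>\<^bsub>B\<^esub> z) = ?g y \<oplus> ?g z"
      using x w by (simp add: gf flip: star_homD(2)[OF f])
    show "?g (y \<otimes>\<^bsub>B\<^esub> z) = ?g y \<otimes> ?g z"
      using x w by (simp add: gf alg_mult_closed flip: star_homD(4)[OF f])
  qed
  then show ?thesis
    unfolding star_isomorphic_def using bij_betw_inv_into[OF bij] by blast
qed

lemma linear_map_star_hom:
  assumes "vectorspace class_ring B" and "f \<in> star_hom A B"
  shows "linear_map class_ring A B f"
  using assms vectorspace_axioms
  by (simp add: linear_map_def mod_hom_def mod_hom_axioms_def vectorspace_def star_hom_def)

text \<open>Transport of structure: each element of \<open>B\<close> is some \<open>f x\<close>, so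
  every law of \<open>B\<close> is the image of the same law of \<open>A\<close>. The value at zero
  is assumed because additivity alone does not determine it before \<open>B\<close> is known to be a
  group.\<close>

lemma isometric_copy:
  assumes f: "f \<in> star_hom A B" and surj: "f ` carrier A = carrier B"
    and zero: "f \<zero> = \<zero>\<^bsub>B\<^esub>"
    and norm: "\<And>x. x \<in> carrier A \<Longrightarrow> cnorm B (f x) = cnorm A x"
    and inj: "inj_on f (carrier A)"
  shows "fd_cstar_algebra B"
proof -
  note fs = star_homD(2-5)[OF f, symmetric]
  have ex: "\<exists>x \<in> carrier A. y = f x" if "y \<in> carrier B" for y
    using surj that by auto
  have fz: "f x = \<zero>\<^bsub>B\<^esub> \<longleftrightarrow> x = \<zero>" if "x \<in> carrier A" for x
    using inj that zero by (metis inj_on_def zero_closed)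
  have "abelian_group B"
  proof (rule abelian_groupI)
    fix x y z assume "x \<in> carrier B" "y \<in> carrier B" "z \<in> carrier B"
    then obtain a b c where *: "a \<in> carrier A" "x = f a" "b \<in> carrier A" "y = f b"
      "c \<in> carrier A" "z = f c" using ex by meson
    show "x \<oplus>\<^bsub>B\<^esub> y \<in> carrier B" using * surj by (auto simp: fs)
    show "(x \<oplus>\<^bsub>B\<^esub> y) \<oplus>\<^bsub>B\<^esub> z = x \<oplus>\<^bsub>B\<^esub> (y \<oplus>\<^bsub>B\<^esub> z)" using * by (simp add: fs a_assoc)
    show "x \<oplus>\<^bsub>B\<^esub> y = y \<oplus>\<^bsub>B\<^esub> x" using * by (simp add: fs a_comm)
    show "\<zero>\<^bsub>B\<^esub> \<oplus>\<^bsub>B\<^esub> x = x" using * by (simp add: fs flip: zero)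
    show "\<exists>y\<in>carrier B. y \<oplus>\<^bsub>B\<^esub> x = \<zero>\<^bsub>B\<^esub>"
      using * surj by (intro bexI[of _ "f (\<ominus> a)"]) (auto simp: fs l_neg simp flip: zero)
  qed (use zero surj in \<open>auto simp flip: zero\<close>)
  then have "Module.module class_ring B"
    by (intro Module.moduleI class_cring.is_cring)
      (auto simp: fs alg_smult_closed alg_smult_simps smult_r_distr surj[symmetric])
  then have vs: "vectorspace class_ring B"
    by (simp add: vectorspace_def class_field)
  interpret B: vectorspace class_ring B by (rule vs)
  have fd: "B.fin_dim"
    by (rule linear_map.surj_fin_dim[OF linear_map_star_hom[OF vs f] finite_dimensional surj])
  show ?thesis
    by (unfold_locales; (rule fd)?)
    (auto simp: fs alg_mult_closed alg_mult_assoc alg_l_distr alg_r_distr alg_smult_closed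
         alg_smult_l alg_smult_r star_closed star_star star_add star_smult star_mult norm
         cnorm_nonneg cnorm_eq_0_iff cnorm_triangle cnorm_smult cnorm_mult cstar_identity
         fz alg_smult_simps surj[symmetric])
qed
end

text \<open>The image of a basis is independent. It is kept inside the range so that its span can
  later be compared with the range.\<close>

lemma (in linear_map) inj_image_basis:
  assumes inj: "inj_on T (carrier V)" and fd: "V.fin_dim"
  obtains B where "finite B" "B \<subseteq> carrier W" "B \<subseteq> T ` carrier V" "W.module.lin_indpt B" "card B = V.dim"
proof -
  obtain B where B: "finite B" "V.basis B"
    using V.finite_basis_exists[OF fd] by blast
  \<comment> \<open>Images of bases are bases only for surjections, so the codomain is first shrunk
    to the range; \<open>span_li_not_depend\<close> carries independence back to
    \<open>W\<close>.\<close>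
  interpret I: vectorspace K "W.vs imT"
    by (rule W.subspace_is_vs[OF imT_is_subspace])
  have sub: "submodule K imT W" by (rule im_is_submodule)
  have "T \<in> carrier V \<rightarrow> carrier (W.vs imT)" by (auto simp: im_def)
  then have lin: "linear_map K V (W.vs imT) T"
    using V.vectorspace_axioms W.subspace_is_vs[OF imT_is_subspace] f_hom
    by (auto simp: linear_map_def mod_hom_def mod_hom_axioms_def vectorspace_def
        LinearCombinations.module_hom_def)
  have "I.basis (T ` B)"
    by (rule linear_map.linear_inj_image_is_basis[OF lin inj _ B(2) fd]) (simp add: im_def)
  then have "I.lin_indpt (T ` B)" "T ` B \<subseteq> imT"
    by (auto simp: I.basis_def)
  then have "W.module.lin_indpt (T ` B)"
    using W.module.span_li_not_depend(2)[OF _ sub] by blast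
  moreover have "card (T ` B) = V.dim"
    using B inj V.dim_basis by (metis V.basis_def card_image inj_on_subset)
  moreover have "T ` B \<subseteq> carrier W" "T ` B \<subseteq> T ` carrier V"
    using B(2) unfolding V.basis_def by auto
  ultimately show ?thesis using B(1) by (intro that[of "T ` B"] finite_imageI)
qed

text \<open>In equal dimension the image of a basis would already span \<open>B\<close>, making the
  embedding onto and hence an isomorphism.\<close>

lemma strictly_embeds_dim_less:
  assumes "fd_cstar_algebra A" and "fd_cstar_algebra B" and "strictly_embeds A B"
  shows "vectorspace.dim class_ring A < vectorspace.dim class_ring B"
proof -
  interpret A: fd_cstar_algebra A by fact
  interpret B: fd_cstar_algebra B by fact
  obtain f where f: "f \<in> star_hom A B" and inj: "inj_on f (carrier A)"
    and not_iso: "\<not> star_isomorphic A B"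
    using assms(3) unfolding strictly_embeds_def embeds_def by blast
  interpret f: linear_map class_ring A B f
    by (rule A.linear_map_star_hom[OF B.vectorspace_axioms f])
  obtain S where S: "finite S" "S \<subseteq> carrier B" "S \<subseteq> f ` carrier A"
    "B.lin_indpt S" "card S = A.dim"
    using f.inj_image_basis[OF inj A.finite_dimensional] by blast
  have "card S \<noteq> B.dim"
  proof
    assume "card S = B.dim"
    then have "B.basis S"
      using S B.dim_li_is_basis[OF B.finite_dimensional] by simp
    then have "carrier B \<subseteq> f ` carrier A"
      using B.span_is_subset[OF S(3)] f.im_is_submodule
      unfolding B.basis_def f.im_def by simp
    moreover have "f ` carrier A \<subseteq> carrier B"
      using star_homD(1)[OF f] by blast
    ultimately have "bij_betw f (carrier A) (carrier B)"
      using inj by (simp add: bij_betw_def)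
    then show False
      using f not_iso unfolding star_isomorphic_def by blast
  qed
  then show ?thesis
    using B.li_le_dim(2)[OF B.finite_dimensional S(2,4)] S(5) by simp
qed

text \<open>Competitors are abstract algebras embedding into \<open>B\<close>, on the carrier type
  used by \<open>forbidden_types\<close>, so that its minimality clause ranges over the same
  algebras.\<close>

lemma forbidden_type_below:
  fixes B :: "complex mat cstar"
  assumes "fd_cstar_algebra B" and "nonzero_alg B" and "\<not> embeds B A"
  obtains C where "C \<in> forbidden_types A" and "embeds C B"
proof -
  let ?P = "\<lambda>C :: complex mat cstar.
    fd_cstar_algebra C \<and> nonzero_alg C \<and> \<not> embeds C A \<and> embeds C B"
  have "?P B" using assms fd_cstar_algebra.embeds_refl[OF assms(1)] by (intro conjI)
  then obtain C where C: "?P C"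
    and least: "\<And>C'. ?P C' \<Longrightarrow> vectorspace.dim class_ring C \<le> vectorspace.dim class_ring C'"
    using ex_has_least_nat[of ?P B "vectorspace.dim class_ring"] by blast
  have "embeds C' A" if "fd_cstar_algebra C'" "nonzero_alg C'" "strictly_embeds C' C"
    for C' :: "complex mat cstar"
  proof -
    have "embeds C' B"
      using that C embeds_trans unfolding strictly_embeds_def by blast
    \<comment> \<open>If \<open>C'\<close> failed to embed into \<open>A\<close>, it would be a
      competitor of smaller dimension than \<open>C\<close>.\<close>
    then show ?thesis
      using that C least[of C'] strictly_embeds_dim_less[of C' C] by fastforce
  qed
  then show ?thesis using that C unfolding forbidden_types_def by blast
qed

section \<open>Matrix copies of abstract algebras\<close>

lemma op_algebra_simps:
  "carrier (op_algebra n) = carrier_mat n n"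
  "monoid.mult (op_algebra n) = (*)"
  "add (op_algebra n) = (+)"
  "zero (op_algebra n) = 0\<^sub>m n n"
  "module.smult (op_algebra n) = (\<cdot>\<^sub>m)"
  "star (op_algebra n) = mat_adjoint"
  by (simp_all add: op_algebra_def module.defs module_mat_def)

lemma op_algebra_vectorspace: "vectorspace class_ring (op_algebra n)"
proof -
  have "abelian_group (op_algebra n)"
  proof (rule abelian_groupI)
    fix X assume "X \<in> carrier (op_algebra n)"
    then show "\<exists>Y \<in> carrier (op_algebra n). Y \<oplus>\<^bsub>op_algebra n\<^esub> X = \<zero>\<^bsub>op_algebra n\<^esub>"
      by (intro bexI[of _ "- X"]) (auto simp: op_algebra_simps)
  qed (auto simp: op_algebra_simps comm_add_mat)
  then have "Module.module class_ring (op_algebra n)"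
    by (intro Module.moduleI class_cring.is_cring)
      (auto simp: op_algebra_simps add_smult_distrib_left_mat add_smult_distrib_right_mat)
  then show ?thesis by (simp add: vectorspace_def class_field)
qed

text \<open>The norm of the copy is read off from \<open>A\<close> through the inverse of
  \<open>\<pi>\<close>, so that all norm axioms are inherited from \<open>A\<close>.\<close>

lemma star_isomorphic_image:
  assumes A: "fd_cstar_algebra A" and \<pi>: "\<pi> \<in> star_hom A (op_algebra n)"
    and inj: "inj_on \<pi> (carrier A)"
  defines "D \<equiv> op_algebra n\<lparr>carrier := \<pi> ` carrier A,
      cnorm := \<lambda>X. cnorm A (inv_into (carrier A) \<pi> X)\<rparr>"
  shows "fd_cstar_algebra D" and "star_isomorphic A D"
proof -
  interpret A: fd_cstar_algebra A by fact
  interpret \<pi>: linear_map class_ring A "op_algebra n" \<pi>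
    by (rule A.linear_map_star_hom[OF op_algebra_vectorspace \<pi>])
  have hom: "\<pi> \<in> star_hom A D"
    using star_homD(2-)[OF \<pi>] by (intro star_homI) (simp_all add: D_def)
  show "fd_cstar_algebra D"
    by (rule A.isometric_copy[OF hom]) (use inj in \<open>simp_all add: D_def\<close>)
  show "star_isomorphic A D"
    unfolding star_isomorphic_def using hom inj by (auto simp: bij_betw_def D_def)
qed

section \<open>Units of *-algebras of matrices\<close>

lemma index_mat_adjoint [simp]:
  fixes X :: "complex mat"
  shows "dim_row (mat_adjoint X) = dim_col X" and "dim_col (mat_adjoint X) = dim_row X"
    and "\<lbrakk>i < dim_col X; j < dim_row X\<rbrakk> \<Longrightarrow> mat_adjoint X $$ (i, j) = cnj (X $$ (j, i))"
  by (simp_all add: mat_adjoint_def mat_of_rows_def)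

lemma mat_adjoint_carrier [simp]:
  "mat_adjoint X \<in> carrier_mat n m \<longleftrightarrow> (X :: complex mat) \<in> carrier_mat m n"
  by (metis carrier_matD carrier_matI index_mat_adjoint(1,2))

lemma mat_adjoint_mat_adjoint [simp]: "mat_adjoint (mat_adjoint X) = (X :: complex mat)"
  by (rule eq_matI) simp_all

lemma mat_adjoint_mult:
  fixes X Y :: "complex mat"
  assumes "X \<in> carrier_mat n m" and "Y \<in> carrier_mat m k"
  shows "mat_adjoint (X * Y) = mat_adjoint Y * mat_adjoint X"
  using assms by (intro eq_matI) (auto simp: scalar_prod_def mult.commute intro!: sum.cong)

lemma mat_adjoint_add:
  fixes X Y :: "complex mat"
  assumes "X \<in> carrier_mat n m" and "Y \<in> carrier_mat n m"
  shows "mat_adjoint (X + Y) = mat_adjoint X + mat_adjoint Y"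
  using assms by (intro eq_matI) auto

lemma mat_adjoint_minus:
  fixes X Y :: "complex mat"
  assumes "X \<in> carrier_mat n m" and "Y \<in> carrier_mat n m"
  shows "mat_adjoint (X - Y) = mat_adjoint X - mat_adjoint Y"
  using assms by (intro eq_matI) auto

lemma mat_adjoint_smult: "mat_adjoint (c \<cdot>\<^sub>m X) = cnj c \<cdot>\<^sub>m mat_adjoint (X :: complex mat)"
  by (rule eq_matI) auto

lemma mat_adjoint_one [simp]: "mat_adjoint (1\<^sub>m n :: complex mat) = 1\<^sub>m n"
  by (rule eq_matI) auto

lemma mat_adjoint_zero [simp]: "mat_adjoint (0\<^sub>m n m :: complex mat) = 0\<^sub>m m n"
  by (rule eq_matI) auto

section \<open>The trace and the Hilbert-Schmidt inner product\<close>

lemma mat_trace_mult: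
  assumes "X \<in> carrier_mat n m" and "Y \<in> carrier_mat m n"
  shows "mat_trace (X * Y) = (\<Sum>i<n. \<Sum>j<m. X $$ (i, j) * Y $$ (j, i))"
  using assms by (simp add: mat_trace_def scalar_prod_def lessThan_atLeast0)

lemma mat_trace_comm:
  assumes "X \<in> carrier_mat n m" and "Y \<in> carrier_mat m n"
  shows "mat_trace (X * Y) = mat_trace (Y * X)"
  unfolding mat_trace_mult[OF assms] mat_trace_mult[OF assms(2,1)]
  by (subst sum.swap) (simp add: mult.commute)

lemma mat_trace_add:
  "\<lbrakk>X \<in> carrier_mat n n; Y \<in> carrier_mat n n\<rbrakk> \<Longrightarrow> mat_trace (X + Y) = mat_trace X + mat_trace Y"
  by (simp add: mat_trace_def sum.distrib)

lemma mat_trace_minus: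
  "\<lbrakk>X \<in> carrier_mat n n; Y \<in> carrier_mat n n\<rbrakk> \<Longrightarrow> mat_trace (X - Y) = mat_trace X - mat_trace Y"
  by (simp add: mat_trace_def sum_subtractf)

lemma mat_trace_smult: "X \<in> carrier_mat n n \<Longrightarrow> mat_trace (c \<cdot>\<^sub>m X) = c * mat_trace X"
  by (simp add: mat_trace_def sum_distrib_left)

lemma mat_trace_zero [simp]: "mat_trace (0\<^sub>m n n) = 0"
  by (simp add: mat_trace_def)

lemma mat_trace_adjoint_self:
  assumes "X \<in> carrier_mat n m"
  shows "mat_trace (X * mat_adjoint X) = complex_of_real (\<Sum>i<n. \<Sum>j<m. (cmod (X $$ (i, j)))\<^sup>2)"
  using assms unfolding of_real_sum complex_norm_square
  by (subst mat_trace_mult[of _ n m]) (auto intro!: sum.cong)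

text \<open>Definiteness of the Hilbert-Schmidt form: the way back from trace identities to matrix
  identities.\<close>

lemma mat_trace_adjoint_self_eq_0:
  assumes X: "X \<in> carrier_mat n m" and "mat_trace (X * mat_adjoint X) = 0"
  shows "X = 0\<^sub>m n m"
proof (rule eq_matI)
  fix i j assume "i < dim_row (0\<^sub>m n m :: complex mat)" "j < dim_col (0\<^sub>m n m :: complex mat)"
  moreover have "(\<Sum>i<n. \<Sum>j<m. (cmod (X $$ (i, j)))\<^sup>2) = 0"
    using assms(2) mat_trace_adjoint_self[OF X] by (simp only: of_real_eq_0_iff)
  ultimately show "X $$ (i, j) = 0\<^sub>m n m $$ (i, j)"
    by (simp add: sum_nonneg_eq_0_iff sum_nonneg)
qed (use X in auto)

abbreviation hs_inner :: "complex mat \<Rightarrow> complex mat \<Rightarrow> complex" where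
  "hs_inner X Y \<equiv> mat_trace (X * mat_adjoint Y)"

lemma hs_inner_diff_smult:
  assumes "M \<in> carrier_mat n n" "N \<in> carrier_mat n n" "X \<in> carrier_mat n n"
  shows "hs_inner (M - c \<cdot>\<^sub>m N) X = hs_inner M X - c * hs_inner N X"
  using assms by (simp add: minus_mult_distrib_mat[of _ n n _ _ n] mat_trace_minus[of _ n]
      mult_smult_assoc_mat[of _ n n _ n] mat_trace_smult[of _ n])

definition mat_subspace :: "nat \<Rightarrow> complex mat set \<Rightarrow> bool" where
  "mat_subspace n S \<longleftrightarrow> S \<subseteq> carrier_mat n n \<and> 0\<^sub>m n n \<in> S \<and>
     (\<forall>X \<in> S. \<forall>Y \<in> S. X + Y \<in> S) \<and> (\<forall>c. \<forall>X \<in> S. c \<cdot>\<^sub>m X \<in> S)"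

lemma mat_subspace_minus:
  assumes "mat_subspace n S" "X \<in> S" "Y \<in> S"
  shows "X - Y \<in> S"
proof -
  have "X - Y = X + (-1) \<cdot>\<^sub>m Y"
    using assms unfolding mat_subspace_def by (intro eq_matI) auto
  then show ?thesis using assms unfolding mat_subspace_def by metis
qed

text \<open>Spreads orthogonality from generators to their span. The form is conjugate-linear in
  \<open>X\<close>, which still leaves its zero set closed under complex multiples.\<close>

lemma mat_subspace_orthogonal:
  assumes M: "M \<in> carrier_mat n n"
  shows "mat_subspace n {X \<in> carrier_mat n n. hs_inner M X = 0}"
  using M unfolding mat_subspace_def
  by (auto simp: mat_adjoint_add mat_adjoint_smult mult_add_distrib_mat[of _ n n _ n]
      mult_smult_distrib[of _ n n _ n] mat_trace_add[of _ n] mat_trace_smult[of _ n])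

text \<open>Quantifying over all subspaces that contain \<open>G\<close> places \<open>E\<close> in the span of \<open>G\<close>.\<close>

lemma hs_projection:
  assumes "finite G" and "G \<subseteq> carrier_mat n n" and "M \<in> carrier_mat n n"
  shows "\<exists>E. (\<forall>S. mat_subspace n S \<and> G \<subseteq> S \<longrightarrow> E \<in> S) \<and> (\<forall>X \<in> G. hs_inner (M - E) X = 0)"
  using assms
proof (induction G arbitrary: M rule: finite_induct)
  case empty
  show ?case by (rule exI[of _ "0\<^sub>m n n"]) (auto simp: mat_subspace_def)
next
  case (insert g G)
  have full: "mat_subspace n (carrier_mat n n)" by (auto simp: mat_subspace_def)
  obtain F where F: "\<And>S. mat_subspace n S \<Longrightarrow> G \<subseteq> S \<Longrightarrow> F \<in> S"
    and gF: "\<And>X. X \<in> G \<Longrightarrow> hs_inner (g - F) X = 0"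
    using insert.IH[of g] insert.prems by auto
  obtain E where E: "\<And>S. mat_subspace n S \<Longrightarrow> G \<subseteq> S \<Longrightarrow> E \<in> S"
    and ME: "\<And>X. X \<in> G \<Longrightarrow> hs_inner (M - E) X = 0"
    using insert.IH[of M] insert.prems by auto
  have carr [simp]: "F \<in> carrier_mat n n" "E \<in> carrier_mat n n" "g \<in> carrier_mat n n"
    "M \<in> carrier_mat n n" "g - F \<in> carrier_mat n n"
    using insert.prems F[OF full] E[OF full] by (auto simp: minus_carrier_mat)
  note [simp] = carr[THEN carrier_matD(1)] carr[THEN carrier_matD(2)]
  \<comment> \<open>Gram-Schmidt: \<open>g - F\<close> is the part of \<open>g\<close> orthogonal to
    \<open>G\<close>, and \<open>c\<close> is the coefficient of \<open>M - E\<close> along it. If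
    \<open>g\<close> already lies in the span of \<open>G\<close>, the denominator is zero and
    division gives \<open>c = 0\<close>.\<close>
  define c where "c = hs_inner (M - E) (g - F) / hs_inner (g - F) (g - F)"
  define E' where "E' = E + c \<cdot>\<^sub>m (g - F)"
  have E'c: "E' \<in> carrier_mat n n" by (simp add: E'_def)
  have ME': "hs_inner (M - E') X = hs_inner (M - E) X - c * hs_inner (g - F) X"
    if "X \<in> carrier_mat n n" for X
  proof -
    have "M - E' = (M - E) - c \<cdot>\<^sub>m (g - F)"
      unfolding E'_def by (intro eq_matI) (auto simp: algebra_simps)
    then show ?thesis
      using that hs_inner_diff_smult[of "M - E" n "g - F" X c] by (simp add: minus_carrier_mat)
  qed
  have G: "hs_inner (M - E') X = 0" if "X \<in> G" for X
    using that ME' ME gF insert.prems by auto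
  have "E' \<in> S" if "mat_subspace n S" "insert g G \<subseteq> S" for S
  proof -
    have "g - F \<in> S" "E \<in> S" using that F E by (auto intro!: mat_subspace_minus)
    then show ?thesis using that unfolding E'_def mat_subspace_def by blast
  qed
  moreover have "hs_inner (M - E') g = 0"
  proof -
    have "hs_inner (M - E') (g - F) = 0"
    proof (cases "hs_inner (g - F) (g - F) = 0")
      case True
      then have "g - F = 0\<^sub>m n n" by (intro mat_trace_adjoint_self_eq_0) simp_all
      moreover have "M - E' \<in> carrier_mat n n" using E'c by (simp add: minus_carrier_mat)
      ultimately show ?thesis using right_mult_zero_mat[of "M - E'" n n n] by simp
    next
      case False
      then show ?thesis by (simp add: ME' c_def)
    qed
    \<comment> \<open>\<open>F\<close> lies in every subspace containing \<open>G\<close>, so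
      orthogonality to \<open>G\<close> covers \<open>F\<close>, and with \<open>g - F\<close> it
      covers \<open>g\<close>.\<close>
    moreover have "F \<in> {X \<in> carrier_mat n n. hs_inner (M - E') X = 0}"
      by (rule F[OF mat_subspace_orthogonal]) (use G insert.prems E'c in \<open>auto simp: minus_carrier_mat\<close>)
    moreover have "hs_inner (M - E') g = hs_inner (M - E') (g - F) + hs_inner (M - E') F"
    proof -
      have "mat_adjoint g = mat_adjoint (g - F) + mat_adjoint F"
        by (intro eq_matI) (use carr in auto)
      moreover have "M - E' \<in> carrier_mat n n" using E'c by (simp add: minus_carrier_mat)
      ultimately show ?thesis
        by (simp add: mult_add_distrib_mat[of _ n n _ n] mat_trace_add[of _ n])
    qed
    ultimately show ?thesis by simp
  qed
  ultimately show ?case using G by (intro exI[of _ E']) auto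
qed

text \<open>The unit is the orthogonal projection \<open>E\<close> of the identity onto the algebra: the relation
  \<open>tr ((1 - E) Z) = 0\<close> for \<open>Z = X (X - E X)*\<close> says that \<open>X - E X\<close> has norm zero.\<close>

lemma unit_projection_exists:
  assumes S: "mat_subspace n S"
    and mult: "\<And>X Y. \<lbrakk>X \<in> S; Y \<in> S\<rbrakk> \<Longrightarrow> X * Y \<in> S"
    and adj: "\<And>X. X \<in> S \<Longrightarrow> mat_adjoint X \<in> S"
    and G: "finite G" "G \<subseteq> S"
    and gen: "\<And>T. \<lbrakk>mat_subspace n T; G \<subseteq> T\<rbrakk> \<Longrightarrow> S \<subseteq> T"
  obtains P where "unit_projection n S P"
proof -
  have carr: "X \<in> carrier_mat n n" if "X \<in> S" for X
    using S that unfolding mat_subspace_def by blast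
  obtain E where ES: "E \<in> S" and ort: "\<And>X. X \<in> G \<Longrightarrow> hs_inner (1\<^sub>m n - E) X = 0"
    using hs_projection[OF G(1), of n "1\<^sub>m n"] G(2) S carr by (auto simp: subset_iff)
  note [simp] = carr[OF ES]
  have sub1: "1\<^sub>m n - E \<in> carrier_mat n n" by (simp add: minus_carrier_mat)
  have "S \<subseteq> {X \<in> carrier_mat n n. hs_inner (1\<^sub>m n - E) X = 0}"
    by (rule gen[OF mat_subspace_orthogonal[OF sub1]]) (use G carr ort in auto)
  then have tr: "mat_trace ((1\<^sub>m n - E) * X) = 0" if "X \<in> S" for X
    using adj[OF that] by auto
  have left: "E * X = X" if X: "X \<in> S" for X
  proof -
    note [simp] = carr[OF X]
    note dims = carrier_matD[OF carr[OF ES]] carrier_matD[OF carr[OF X]]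
    have d: "(1\<^sub>m n - E) * X = X - E * X"
      using left_mult_one_mat[OF carr[OF X]] by (simp add: minus_mult_distrib_mat[of _ n n _ _ n])
    have dS: "X - E * X \<in> S" using ES X mult S by (auto intro!: mat_subspace_minus)
    have "hs_inner (X - E * X) (X - E * X) = mat_trace ((1\<^sub>m n - E) * (X * mat_adjoint (X - E * X)))"
      using carr[OF dS] sub1 by (simp add: assoc_mult_mat[of _ n n _ n _ n] flip: d)
    also have "\<dots> = 0" using X dS adj mult by (intro tr) simp
    finally have "X - E * X = 0\<^sub>m n n"
      using carr[OF dS] by (intro mat_trace_adjoint_self_eq_0)
    then have "E * X + (X - E * X) = E * X + 0\<^sub>m n n" by (rule arg_cong)
    moreover have "E * X + (X - E * X) = X" by (intro eq_matI) (auto simp: dims)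
    ultimately show ?thesis
      using right_add_zero_mat[OF mult_carrier_mat[OF carr[OF ES] carr[OF X]]] by simp
  qed
  have adjE: "mat_adjoint E = E"
  proof -
    \<comment> \<open>Since \<open>E\<close> is a left unit, \<open>E * mat_adjoint E\<close> equals
      \<open>mat_adjoint E\<close>, and the product is self-adjoint.\<close>
    have "mat_adjoint (E * mat_adjoint E) = E * mat_adjoint E"
      by (simp add: mat_adjoint_mult[of _ n n _ n])
    then show ?thesis using left[OF adj[OF ES]] by simp
  qed
  have "X * E = X" if "X \<in> S" for X
  proof -
    have "mat_adjoint (E * mat_adjoint X) = X * E"
      using carr[OF that] adjE by (simp add: mat_adjoint_mult[of _ n n _ n])
    then show ?thesis using left[OF adj[OF that]] by simp
  qed
  then have "unit_projection n S E"
    using ES adjE left unfolding unit_projection_def by blast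
  then show ?thesis by (rule that)
qed

section \<open>Isometries onto the range of a projection\<close>

lemma projection_diff:
  fixes P Q :: "complex mat"
  assumes [simp]: "P \<in> carrier_mat n n" "Q \<in> carrier_mat n n"
    and "P * P = P" "Q * Q = Q" "P * Q = Q" "Q * P = Q"
  shows "(P - Q) * (P - Q) = P - Q"
proof -
  have "(P - Q) * (P - Q) = P - Q - (Q - Q)"
    using assms
    by (simp add: mult_minus_distrib_mat[of _ n n _ n] minus_mult_distrib_mat[of _ n n _ _ n] minus_carrier_mat)
  also have "\<dots> = P - Q"
    using carrier_matD[OF assms(1)] carrier_matD[OF assms(2)] by (intro eq_matI) auto
  finally show ?thesis .
qed

text \<open>The Gram matrix of the enlarged list of columns is the identity because \<open>v\<close>
  is a unit vector orthogonal to the columns of \<open>W\<close>; the new column adds its own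
  rank-one projection to \<open>P\<close>.\<close>

lemma append_column:
  assumes W: "subspace_inclusion n k P W" and v: "v \<in> carrier_mat n 1"
    and unit: "mat_adjoint v * v = 1\<^sub>m 1" and orth: "mat_adjoint W * v = 0\<^sub>m k 1"
  shows "subspace_inclusion n (Suc k) (P + v * mat_adjoint v)
     (mat n (Suc k) (\<lambda>(i, a). if a < k then W $$ (i, a) else v $$ (i, 0)))"
    (is "subspace_inclusion n _ _ ?U")
proof -
  have [simp]: "dim_row W = n" "dim_col W = k" "dim_row v = n" "dim_col v = 1"
    and P: "P = W * mat_adjoint W" and WW: "mat_adjoint W * W = 1\<^sub>m k"
    using W v by (auto simp: subspace_inclusion_def)
  have entry: "(\<Sum>i<n. cnj (X $$ (i, a)) * Y $$ (i, b)) = (mat_adjoint X * Y) $$ (a, b)"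
    if "dim_row X = n" "dim_row Y = n" "a < dim_col X" "b < dim_col Y" for X Y a b
    using that by (simp add: scalar_prod_def lessThan_atLeast0)
  \<comment> \<open>\<open>orth\<close> covers the products of columns of \<open>W\<close> with
    \<open>v\<close>; those in the other order are their conjugates.\<close>
  have flip: "(\<Sum>i<n. cnj (v $$ (i, 0)) * W $$ (i, a)) = cnj (\<Sum>i<n. cnj (W $$ (i, a)) * v $$ (i, 0))" for a
    by (simp add: mult.commute)
  have "(mat_adjoint ?U * ?U) $$ (a, b) = 1\<^sub>m (Suc k) $$ (a, b)" if ab: "a < Suc k" "b < Suc k" for a b
  proof -
    have "(mat_adjoint ?U * ?U) $$ (a, b) = (\<Sum>i<n. cnj (?U $$ (i, a)) * ?U $$ (i, b))"
      using ab by (subst entry) auto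
    also have "\<dots> = (\<Sum>i<n. cnj (if a < k then W $$ (i, a) else v $$ (i, 0)) *
        (if b < k then W $$ (i, b) else v $$ (i, 0)))"
      using ab by (intro sum.cong) auto
    also have "\<dots> = 1\<^sub>m (Suc k) $$ (a, b)"
      using ab by (cases "a < k"; cases "b < k")
        (auto simp: flip entry WW unit orth less_Suc_eq simp del: cnj_sum)
    finally show ?thesis .
  qed
  then have "mat_adjoint ?U * ?U = 1\<^sub>m (Suc k)"
    by (intro eq_matI) auto
  moreover have "?U * mat_adjoint ?U = P + v * mat_adjoint v"
    unfolding P by (intro eq_matI) (auto simp: scalar_prod_def less_Suc_eq)
  ultimately show ?thesis by (simp add: subspace_inclusion_def)
qed

text \<open>Induction on the trace: split off a normalised nonzero column of \<open>P\<close>.\<close>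

lemma subspace_inclusion_exists:
  assumes "P \<in> carrier_mat n n" and "P * P = P" and "mat_adjoint P = P"
  shows "\<exists>k W. subspace_inclusion n k P W"
proof -
  \<comment> \<open>The trace is the rank, but it is handled only as a real number; a strict natural
    upper bound serves as the induction measure.\<close>
  have "\<exists>k W. subspace_inclusion n k P W"
    if "P \<in> carrier_mat n n" "P * P = P" "mat_adjoint P = P" "Re (mat_trace P) < real N" for N P
    using that
  proof (induction N arbitrary: P)
    case 0
    \<comment> \<open>For a projection \<open>P P* = P\<close>, so its trace is a squared norm and
      cannot be negative.\<close>
    have "mat_trace P = complex_of_real (\<Sum>i<n. \<Sum>j<n. (cmod (P $$ (i, j)))\<^sup>2)"
      using mat_trace_adjoint_self[OF 0(1)] 0(2,3) by simp
    then have "Re (mat_trace P) \<ge> 0" by (simp add: sum_nonneg)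
    then show ?case using 0 by simp
  next
    case (Suc N)
    note [simp] = Suc.prems(1) carrier_matD[OF Suc.prems(1)]
    \<comment> \<open>Entry \<open>(j, j)\<close> of \<open>P* P = P\<close> is the squared length
      of column \<open>j\<close>, so a zero diagonal forces \<open>P = 0\<close>.\<close>
    have diag: "P $$ (j, j) = complex_of_real (\<Sum>i<n. (cmod (P $$ (i, j)))\<^sup>2)" if "j < n" for j
    proof -
      have "P $$ (j, j) = (mat_adjoint P * P) $$ (j, j)" using Suc.prems(2,3) by simp
      also have "\<dots> = (\<Sum>i<n. cnj (P $$ (i, j)) * P $$ (i, j))"
        using that by (simp add: scalar_prod_def lessThan_atLeast0)
      also have "\<dots> = complex_of_real (\<Sum>i<n. (cmod (P $$ (i, j)))\<^sup>2)"
        unfolding of_real_sum complex_norm_square by (simp add: mult.commute)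
      finally show ?thesis .
    qed
    show ?case
    proof (cases "\<forall>j<n. P $$ (j, j) = 0")
      case True
      have "P $$ (i, j) = 0" if "i < n" "j < n" for i j
      proof -
        have "(\<Sum>i<n. (cmod (P $$ (i, j)))\<^sup>2) = 0"
          using True diag[OF that(2)] that(2) of_real_eq_0_iff by metis
        then show ?thesis using that by (simp add: sum_nonneg_eq_0_iff)
      qed
      then have "P = 0\<^sub>m n n" by (intro eq_matI) auto
      \<comment> \<open>The isometry from the zero space has no columns.\<close>
      then have "subspace_inclusion n 0 P (0\<^sub>m n 0)"
        by (auto simp: subspace_inclusion_def intro!: eq_matI)
      then show ?thesis by blast
    next
      case False
      then obtain j where j: "j < n" "P $$ (j, j) \<noteq> 0" by blast
      define p where "p = (\<Sum>i<n. (cmod (P $$ (i, j)))\<^sup>2)"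
      have Pjj: "P $$ (j, j) = complex_of_real p" using diag[OF j(1)] by (simp add: p_def)
      have "p \<ge> 0" by (simp add: p_def sum_nonneg)
      with j Pjj have p: "p > 0" by (cases "p = 0") auto
      \<comment> \<open>Column \<open>j\<close> has squared length \<open>p\<close>, and
        \<open>P P = P\<close> puts it in the range of \<open>P\<close>.\<close>
      define v where "v = mat n 1 (\<lambda>(i, _). P $$ (i, j) / complex_of_real (sqrt p))"
      have v [simp]: "v \<in> carrier_mat n 1" "dim_row v = n" "dim_col v = 1" by (auto simp: v_def)
      note [simp] = v(1)[unfolded One_nat_def]
      have sq: "complex_of_real (sqrt p) * complex_of_real (sqrt p) = complex_of_real p"
        using p by (simp flip: of_real_mult)
      have unit: "mat_adjoint v * v = 1\<^sub>m 1"
      proof (rule eq_matI)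
        fix a b assume "a < dim_row (1\<^sub>m 1 :: complex mat)" "b < dim_col (1\<^sub>m 1 :: complex mat)"
        then have ab: "a = 0" "b = 0" by auto
        have "(mat_adjoint v * v) $$ (0, 0) = (\<Sum>i<n. cnj (P $$ (i, j)) * P $$ (i, j)) / complex_of_real p"
          using sq by (simp add: scalar_prod_def lessThan_atLeast0 v_def sum_divide_distrib)
        also have "(\<Sum>i<n. cnj (P $$ (i, j)) * P $$ (i, j)) = complex_of_real p"
          unfolding p_def of_real_sum complex_norm_square by (simp add: mult.commute)
        finally show "(mat_adjoint v * v) $$ (a, b) = 1\<^sub>m 1 $$ (a, b)"
          using p ab by simp
      qed simp_all
      have Pv: "P * v = v"
      proof (rule eq_matI)
        fix i b assume "i < dim_row v" "b < dim_col v"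
        then have ib: "i < n" "b = 0" by auto
        have "(P * v) $$ (i, 0) = (P * P) $$ (i, j) / complex_of_real (sqrt p)"
          using ib j by (simp add: scalar_prod_def v_def sum_divide_distrib)
        then show "(P * v) $$ (i, b) = v $$ (i, b)"
          using ib j Suc.prems(2) by (simp add: v_def)
      qed simp_all
      define Q where "Q = v * mat_adjoint v"
      have Q [simp]: "Q \<in> carrier_mat n n" "dim_row Q = n" "dim_col Q = n" by (auto simp: Q_def)
      have adjQ: "mat_adjoint Q = Q"
        unfolding Q_def by (simp add: mat_adjoint_mult[of _ n 1 _ n])
      have PQ: "P * Q = Q"
        unfolding Q_def by (simp add: Pv flip: assoc_mult_mat[of _ n n _ 1 _ n])
      have QP: "Q * P = Q"
        using arg_cong[OF PQ, of mat_adjoint] Suc.prems(3) adjQ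
        by (simp add: mat_adjoint_mult[of _ n n _ n])
      have Qv: "Q * v = v"
        unfolding Q_def by (simp add: unit assoc_mult_mat[of _ n 1 _ n _ 1])
      have "Q * Q = Q * (v * mat_adjoint v)" by (simp only: Q_def)
      also have "\<dots> = Q * v * mat_adjoint v"
        by (rule assoc_mult_mat[symmetric, of _ n n _ 1 _ n]) simp_all
      also have "\<dots> = Q" unfolding Qv by (simp only: Q_def)
      finally have QQ: "Q * Q = Q" .
      have R: "P - Q \<in> carrier_mat n n" "(P - Q) * (P - Q) = P - Q" "mat_adjoint (P - Q) = P - Q"
        using projection_diff[of P n Q] PQ QP QQ Suc.prems adjQ
        by (auto simp: mat_adjoint_minus[of _ n n] minus_carrier_mat)
      \<comment> \<open>The trace of \<open>Q\<close> is the squared length of \<open>v\<close>, so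
        splitting off \<open>Q\<close> lowers the trace by exactly 1.\<close>
      have "mat_trace Q = 1"
        unfolding Q_def using unit
        by (subst mat_trace_comm[of _ n 1]) (simp_all add: mat_trace_def)
      then have "Re (mat_trace (P - Q)) < real N"
        using Suc.prems(4) by (simp add: mat_trace_minus[of _ n])
      then obtain k W where W: "subspace_inclusion n k (P - Q) W"
        using Suc.IH[OF R] by blast
      then have [simp]: "W \<in> carrier_mat n k" and WW: "mat_adjoint W * W = 1\<^sub>m k"
        and WP: "W * mat_adjoint W = P - Q"
        by (auto simp: subspace_inclusion_def)
      have z: "(P - Q) * v = 0\<^sub>m n 1"
        by (simp add: minus_mult_distrib_mat[of _ n n _ _ 1] Pv Qv)
      \<comment> \<open>\<open>W* v = W* W W* v = W* (P - Q) v\<close>, and \<open>P - Q\<close>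
        annihilates \<open>v\<close>.\<close>
      have "mat_adjoint W * v = (mat_adjoint W * W) * (mat_adjoint W * v)"
        by (simp add: WW left_mult_one_mat[of _ k 1] mult_carrier_mat[of _ k n])
      also have "\<dots> = mat_adjoint W * ((W * mat_adjoint W) * v)"
        by (simp add: assoc_mult_mat[of _ k n _ k _ 1] assoc_mult_mat[of _ n k _ n _ 1]
            mult_carrier_mat[of _ k n])
      also have "\<dots> = 0\<^sub>m k 1" by (simp add: WP z right_mult_zero_mat[of _ k n])
      finally have "subspace_inclusion n (Suc k) (P - Q + v * mat_adjoint v)
         (mat n (Suc k) (\<lambda>(i, a). if a < k then W $$ (i, a) else v $$ (i, 0)))"
        by (intro append_column[OF W v(1) unit])
      moreover have "P - Q + v * mat_adjoint v = P"
        unfolding Q_def[symmetric] by (intro eq_matI) auto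
      ultimately show ?thesis by auto
    qed
  qed
  moreover obtain N where "Re (mat_trace P) < real N" using reals_Archimedean2 by blast
  ultimately show ?thesis using assms by blast
qed

section \<open>Channels\<close>

lemma mult_vec_inner:
  fixes M :: "complex mat"
  assumes "M \<in> carrier_mat n m" and "v \<in> carrier_vec m" and "w \<in> carrier_vec n"
  shows "(M *\<^sub>v v) \<bullet>c w = (\<Sum>r<n. \<Sum>s<m. M $$ (r, s) * v $ s * cnj (w $ r))"
  using assms by (simp add: scalar_prod_def lessThan_atLeast0 sum_distrib_right)

lemma mult_vec_inner_adjoint:
  fixes M :: "complex mat"
  assumes "M \<in> carrier_mat n m" and "v \<in> carrier_vec m" and "w \<in> carrier_vec n"
  shows "(M *\<^sub>v v) \<bullet>c w = v \<bullet>c (mat_adjoint M *\<^sub>v w)"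
proof -
  have "v \<bullet>c (mat_adjoint M *\<^sub>v w) = (\<Sum>s<m. \<Sum>r<n. M $$ (r, s) * v $ s * cnj (w $ r))"
    using assms by (simp add: scalar_prod_def lessThan_atLeast0 sum_distrib_left mult_ac)
  then show ?thesis
    unfolding mult_vec_inner[OF assms] by (subst sum.swap) simp
qed

text \<open>Moving \<open>B\<close> across the inner product evaluates the quadratic form of
  \<open>X\<close> at \<open>B* v\<close>.\<close>

lemma pos_semidef_conj:
  assumes X: "pos_semidef m X" and B: "B \<in> carrier_mat n m"
  shows "pos_semidef n (B * X * mat_adjoint B)"
  unfolding pos_semidef_def
proof (intro conjI ballI)
  have Xc: "X \<in> carrier_mat m m" using X by (simp add: pos_semidef_def)
  show "B * X * mat_adjoint B \<in> carrier_mat n n"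
    using B Xc by simp
  fix v :: "complex vec" assume v: "v \<in> carrier_vec n"
  let ?w = "mat_adjoint B *\<^sub>v v"
  have w: "?w \<in> carrier_vec m" using B v by (intro mult_mat_vec_carrier) simp_all
  have "(B * X * mat_adjoint B) *\<^sub>v v = B *\<^sub>v (X *\<^sub>v ?w)"
    using B Xc v w by (simp add: assoc_mult_mat_vec[of _ n m _ n] assoc_mult_mat_vec[of _ n m _ m]
        mult_carrier_mat[of _ n m])
  then have "((B * X * mat_adjoint B) *\<^sub>v v) \<bullet>c v = (X *\<^sub>v ?w) \<bullet>c ?w"
    using mult_vec_inner_adjoint[OF B mult_mat_vec_carrier[OF Xc w] v] by simp
  then show "0 \<le> ((B * X * mat_adjoint B) *\<^sub>v v) \<bullet>c v"
    using X w by (simp add: pos_semidef_def)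
qed

lemma pos_semidef_sum:
  assumes "\<And>j. j < J \<Longrightarrow> pos_semidef n (M j)"
  shows "pos_semidef n (mat n n (\<lambda>rs. \<Sum>j<J. M j $$ rs))" (is "pos_semidef n ?S")
  unfolding pos_semidef_def
proof (intro conjI ballI)
  fix v :: "complex vec" assume v: "v \<in> carrier_vec n"
  have "(?S *\<^sub>v v) \<bullet>c v = (\<Sum>r<n. \<Sum>s<n. \<Sum>j<J. M j $$ (r, s) * v $ s * cnj (v $ r))"
    using v by (subst mult_vec_inner[of _ n n]) (auto simp: sum_distrib_right)
  also have "\<dots> = (\<Sum>r<n. \<Sum>j<J. \<Sum>s<n. M j $$ (r, s) * v $ s * cnj (v $ r))"
    by (intro sum.cong refl sum.swap)
  also have "\<dots> = (\<Sum>j<J. \<Sum>r<n. \<Sum>s<n. M j $$ (r, s) * v $ s * cnj (v $ r))"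
    by (rule sum.swap)
  also have "\<dots> = (\<Sum>j<J. (M j *\<^sub>v v) \<bullet>c v)"
    using assms v by (intro sum.cong refl mult_vec_inner[symmetric]) (simp_all add: pos_semidef_def)
  also have "\<dots> \<ge> 0"
    using assms v by (intro sum_nonneg) (simp add: pos_semidef_def)
  finally show "0 \<le> (?S *\<^sub>v v) \<bullet>c v" .
qed simp

lemma index_bound:
  fixes m :: nat
  shows "\<lbrakk>\<alpha> < a; i < m\<rbrakk> \<Longrightarrow> \<alpha> * m + i < a * m"
  by (metis add.commute add_less_mono1 less_le_trans mult_Suc mult_le_mono1 Suc_leI)

text \<open>Summation in block coordinates, matching the \<open>div\<close> and \<open>mod\<close>
  of \<open>ampliation\<close>.\<close>

lemma sum_div_mod:
  fixes m :: nat
  shows "(\<Sum>t<a * m. f t) = (\<Sum>\<alpha><a. \<Sum>p<m. f (\<alpha> * m + p))"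
proof -
  have "(\<Sum>p<m. f (\<alpha> * m + p)) = sum f {\<alpha> * m..<\<alpha> * m + m}" for \<alpha>
    using sum.shift_bounds_nat_ivl[of f 0 "\<alpha> * m" m]
    by (simp add: lessThan_atLeast0 add.commute)
  then show ?thesis by (simp add: sum.nat_group)
qed

text \<open>The operator \<open>1 \<otimes> R\<close> in the block conventions of \<open>ampliation\<close>.\<close>

definition block_diagonal :: "nat \<Rightarrow> nat \<Rightarrow> nat \<Rightarrow> complex mat \<Rightarrow> complex mat" where
  "block_diagonal a k m R = mat (a * k) (a * m)
     (\<lambda>(r, t). if r div k = t div m then R $$ (r mod k, t mod m) else 0)"

text \<open>Block-diagonal factors do not mix blocks, so conjugation by \<open>1 \<otimes> R\<close>
  is the ampliation of \<open>Y \<mapsto> R Y R*\<close>.\<close>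

lemma block_diagonal_conj:
  assumes R: "R \<in> carrier_mat k m" and X: "X \<in> carrier_mat (a * m) (a * m)"
    and r: "r < a * k" and s: "s < a * k"
  shows "(block_diagonal a k m R * X * mat_adjoint (block_diagonal a k m R)) $$ (r, s) =
    (R * mat_block m X (r div k) (s div k) * mat_adjoint R) $$ (r mod k, s mod k)"
proof -
  let ?B = "block_diagonal a k m R"
  have k: "k > 0" using r by (cases k) auto
  have bounds: "r div k < a" "s div k < a" "r mod k < k" "s mod k < k"
    using r s k by (simp_all add: less_mult_imp_div_less)
  have [simp]: "dim_row X = a * m" "dim_col X = a * m" "dim_row R = k" "dim_col R = m"
    "dim_row ?B = a * k" "dim_col ?B = a * m"
    using X R by (auto simp: block_diagonal_def)
  have B: "?B $$ (r, \<alpha> * m + p) = (if r div k = \<alpha> then R $$ (r mod k, p) else 0)"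
    if "r < a * k" "\<alpha> < a" "p < m" for r \<alpha> p
    using that index_bound[of \<alpha> a p m] by (simp add: block_diagonal_def)
  \<comment> \<open>In row \<open>r\<close> only the block with number \<open>r div k\<close> is
    nonzero.\<close>
  have row: "(\<Sum>t<a * m. ?B $$ (r, t) * f t) = (\<Sum>p<m. R $$ (r mod k, p) * f (r div k * m + p))"
    if r: "r < a * k" "r div k < a" for r and f :: "nat \<Rightarrow> complex"
  proof -
    have "(\<Sum>t<a * m. ?B $$ (r, t) * f t) =
        (\<Sum>\<alpha><a. if r div k = \<alpha> then \<Sum>p<m. R $$ (r mod k, p) * f (\<alpha> * m + p) else 0)"
      unfolding sum_div_mod using r by (intro sum.cong refl) (auto simp: B)
    then show ?thesis using r by simp
  qed
  have "(?B * X * mat_adjoint ?B) $$ (r, s) =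
      (\<Sum>u<a * m. (\<Sum>t<a * m. ?B $$ (r, t) * X $$ (t, u)) * cnj (?B $$ (s, u)))"
    using r s by (simp add: scalar_prod_def lessThan_atLeast0)
  also have "\<dots> = (\<Sum>u<a * m. (\<Sum>p<m. R $$ (r mod k, p) * X $$ (r div k * m + p, u)) * cnj (?B $$ (s, u)))"
    using row[OF r bounds(1)] by simp
  \<comment> \<open>Conjugating the whole sum brings the adjoint factor into the shape that
    \<open>row\<close> handles.\<close>
  also have "\<dots> = cnj (\<Sum>u<a * m. ?B $$ (s, u) * cnj (\<Sum>p<m. R $$ (r mod k, p) * X $$ (r div k * m + p, u)))"
    by (simp add: mult.commute)
  also have "\<dots> = (\<Sum>q<m. (\<Sum>p<m. R $$ (r mod k, p) * X $$ (r div k * m + p, s div k * m + q))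
      * cnj (R $$ (s mod k, q)))"
    unfolding row[OF s bounds(2)] by (simp add: mult.commute)
  also have "\<dots> = (R * mat_block m X (r div k) (s div k) * mat_adjoint R) $$ (r mod k, s mod k)"
    using bounds by (simp add: scalar_prod_def lessThan_atLeast0 mat_block_def)
  finally show ?thesis .
qed

text \<open>The operator-sum form of a completely positive map. Entries are summed, so the value is
  \<open>k\<close> by \<open>k\<close> even for \<open>J = 0\<close>.\<close>

definition kraus_map :: "nat \<Rightarrow> nat \<Rightarrow> (nat \<Rightarrow> complex mat) \<Rightarrow> complex mat \<Rightarrow> complex mat" where
  "kraus_map k J R Y = mat k k (\<lambda>rs. \<Sum>j<J. (R j * Y * mat_adjoint (R j)) $$ rs)"

text \<open>The ampliation of an operator sum is the operator sum of the
  \<open>1 \<otimes> R j\<close>, and both conjugation and addition preserve positivity.\<close>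

lemma completely_positive_kraus_map:
  assumes "\<And>j. j < J \<Longrightarrow> R j \<in> carrier_mat k m"
  shows "completely_positive m k (kraus_map k J R)"
  unfolding completely_positive_def
proof (intro allI impI)
  fix a X assume X: "pos_semidef (a * m) X"
  then have Xc: "X \<in> carrier_mat (a * m) (a * m)" by (simp add: pos_semidef_def)
  let ?B = "\<lambda>j. block_diagonal a k m (R j)"
  have "ampliation a m k (kraus_map k J R) X =
      mat (a * k) (a * k) (\<lambda>rs. \<Sum>j<J. (?B j * X * mat_adjoint (?B j)) $$ rs)"
  proof (rule eq_matI)
    fix r s
    assume "r < dim_row (mat (a * k) (a * k) (\<lambda>rs. \<Sum>j<J. (?B j * X * mat_adjoint (?B j)) $$ rs))"
      and "s < dim_col (mat (a * k) (a * k) (\<lambda>rs. \<Sum>j<J. (?B j * X * mat_adjoint (?B j)) $$ rs))"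
    then have rs: "r < a * k" "s < a * k" by simp_all
    \<comment> \<open>A row index exists, so \<open>k\<close> is positive and remainders modulo
      \<open>k\<close> are valid indices.\<close>
    then have "k > 0" by (cases k) auto
    then show "ampliation a m k (kraus_map k J R) X $$ (r, s) =
        mat (a * k) (a * k) (\<lambda>rs. \<Sum>j<J. (?B j * X * mat_adjoint (?B j)) $$ rs) $$ (r, s)"
      using rs assms Xc by (simp add: ampliation_def kraus_map_def block_diagonal_conj)
  qed (simp_all add: ampliation_def)
  moreover have "?B j \<in> carrier_mat (a * k) (a * m)" for j
    by (simp add: block_diagonal_def)
  ultimately show "pos_semidef (a * k) (ampliation a m k (kraus_map k J R) X)"
    by (simp add: pos_semidef_sum pos_semidef_conj[OF X])
qed

text \<open>The blocks of the inner ampliation are \<open>f\<close> of the blocks of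
  \<open>X\<close>; hence complete positivity is stable under composition.\<close>

lemma ampliation_comp:
  assumes f: "\<And>X. X \<in> carrier_mat n n \<Longrightarrow> f X \<in> carrier_mat m m"
  shows "ampliation a n k (g \<circ> f) X = ampliation a m k g (ampliation a n m f X)"
proof (rule eq_matI)
  fix r s
  assume "r < dim_row (ampliation a m k g (ampliation a n m f X))"
    and "s < dim_col (ampliation a m k g (ampliation a n m f X))"
  then have rs: "r < a * k" "s < a * k" by (simp_all add: ampliation_def)
  then have "r div k < a" "s div k < a" by (simp_all add: less_mult_imp_div_less)
  then have "mat_block m (ampliation a n m f X) (r div k) (s div k) =
      f (mat_block n X (r div k) (s div k))"
    using f[of "mat_block n X (r div k) (s div k)"]
    by (intro eq_matI) (auto simp: mat_block_def ampliation_def index_bound)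
  then show "ampliation a n k (g \<circ> f) X $$ (r, s) =
      ampliation a m k g (ampliation a n m f X) $$ (r, s)"
    using rs by (simp add: ampliation_def)
qed (simp_all add: ampliation_def)

section \<open>Linear maps and their adjoints for the trace form\<close>

abbreviation linear_maps :: "nat \<Rightarrow> nat \<Rightarrow> (complex mat \<Rightarrow> complex mat) set" where
  "linear_maps n m \<equiv> LinearCombinations.module_hom (class_ring :: complex ring) (op_algebra n) (op_algebra m)"

lemma linear_maps_iff:
  "f \<in> linear_maps n m \<longleftrightarrow> (\<forall>X \<in> carrier_mat n n. f X \<in> carrier_mat m m) \<and>
     (\<forall>X \<in> carrier_mat n n. \<forall>Y \<in> carrier_mat n n. f (X + Y) = f X + f Y) \<and>
     (\<forall>c. \<forall>X \<in> carrier_mat n n. f (c \<cdot>\<^sub>m X) = c \<cdot>\<^sub>m f X)"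
  by (auto simp: LinearCombinations.module_hom_def op_algebra_simps)

lemma linear_maps_comp: "\<lbrakk>f \<in> linear_maps n m; g \<in> linear_maps m k\<rbrakk> \<Longrightarrow> g \<circ> f \<in> linear_maps n k"
  by (simp add: linear_maps_iff)

lemma linear_maps_conj:
  assumes B: "B \<in> carrier_mat n m"
  shows "(\<lambda>X. B * X * mat_adjoint B) \<in> linear_maps m n"
  unfolding linear_maps_iff using B
  by (auto simp: mult_add_distrib_mat[of _ n m _ m] add_mult_distrib_mat[of _ n m _ _ n]
      mult_smult_distrib[of _ n m _ m] mult_smult_assoc_mat[of _ n m _ n])

lemma linear_maps_kraus_map:
  assumes "\<And>j. j < J \<Longrightarrow> R j \<in> carrier_mat k m"
  shows "kraus_map k J R \<in> linear_maps m k"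
proof -
  have "R j * (X + Y) * mat_adjoint (R j) = R j * X * mat_adjoint (R j) + R j * Y * mat_adjoint (R j)"
    "R j * (c \<cdot>\<^sub>m X) * mat_adjoint (R j) = c \<cdot>\<^sub>m (R j * X * mat_adjoint (R j))"
    if "j < J" "X \<in> carrier_mat m m" "Y \<in> carrier_mat m m" for j X Y c
    using linear_maps_conj[OF assms[OF that(1)]] that unfolding linear_maps_iff by auto
  moreover have "dim_row (R j) = k" if "j < J" for j using assms[OF that] by simp
  ultimately show ?thesis
    unfolding linear_maps_iff
    by (auto simp: kraus_map_def sum.distrib sum_distrib_left intro!: eq_matI cong: sum.cong_simp)
qed

lemma quantum_channel_comp:
  assumes f: "quantum_channel n m f" and g: "quantum_channel m k g"
  shows "quantum_channel n k (g \<circ> f)"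
proof -
  have lin: "f \<in> linear_maps n m" "g \<in> linear_maps m k"
    using assms by (simp_all add: quantum_channel_def)
  have carr: "\<And>X. X \<in> carrier_mat n n \<Longrightarrow> f X \<in> carrier_mat m m"
    using lin by (simp add: linear_maps_iff)
  then show ?thesis
    using assms linear_maps_comp[OF lin]
    by (simp add: quantum_channel_def completely_positive_def ampliation_comp[OF carr])
qed

text \<open>The trace form is nondegenerate: the difference of two candidates, tested against its
  own adjoint, has Hilbert-Schmidt norm zero.\<close>

lemma map_adjoint_eqI:
  assumes Z: "Z \<in> carrier_mat n n"
    and eq: "\<And>X. X \<in> carrier_mat n n \<Longrightarrow> mat_trace (Y * f X) = mat_trace (Z * X)"
  shows "map_adjoint n m f Y = Z"
  unfolding map_adjoint_def
proof (rule the_equality)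
  fix Z' assume "Z' \<in> carrier_mat n n \<and> (\<forall>X \<in> carrier_mat n n. mat_trace (Y * f X) = mat_trace (Z' * X))"
  then have Z': "Z' \<in> carrier_mat n n"
    and eq': "\<And>X. X \<in> carrier_mat n n \<Longrightarrow> mat_trace (Z' * X) = mat_trace (Z * X)"
    using eq by auto
  have c: "Z' - Z \<in> carrier_mat n n" using Z by (simp add: minus_carrier_mat)
  have "mat_trace ((Z' - Z) * mat_adjoint (Z' - Z)) = 0"
    using Z Z' c eq'[of "mat_adjoint (Z' - Z)"]
    by (simp add: minus_mult_distrib_mat[of _ n n _ _ n] mat_trace_minus[of _ n])
  then have zero: "Z' - Z = 0\<^sub>m n n" by (rule mat_trace_adjoint_self_eq_0[OF c])
  show "Z' = Z"
  proof (rule eq_matI)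
    fix i j assume "i < dim_row Z" "j < dim_col Z"
    then have "(Z' - Z) $$ (i, j) = 0" unfolding zero using Z by auto
    then show "Z' $$ (i, j) = Z $$ (i, j)" using \<open>i < dim_row Z\<close> \<open>j < dim_col Z\<close> by simp
  qed (use Z Z' in auto)
qed (use assms in auto)

text \<open>Expansion in matrix units; the induction adds one entry of \<open>X\<close> at a
  time.\<close>

lemma linear_functional_expansion:
  fixes g :: "complex mat \<Rightarrow> complex"
  assumes add: "\<And>X Y. \<lbrakk>X \<in> carrier_mat n n; Y \<in> carrier_mat n n\<rbrakk> \<Longrightarrow> g (X + Y) = g X + g Y"
    and smult: "\<And>c X. X \<in> carrier_mat n n \<Longrightarrow> g (c \<cdot>\<^sub>m X) = c * g X"
    and X: "X \<in> carrier_mat n n"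
  shows "g X = (\<Sum>(i, j) \<in> {..<n} \<times> {..<n}. X $$ (i, j) * g (mat n n (\<lambda>p. of_bool (p = (i, j)))))"
proof -
  have "g (mat n n (\<lambda>p. if p \<in> I then X $$ p else 0)) =
      (\<Sum>p \<in> I. X $$ p * g (mat n n (\<lambda>q. of_bool (q = p))))" if "finite I" for I
    using that
  proof (induction I rule: finite_induct)
    case empty
    have "mat n n (\<lambda>p. 0) = 0 \<cdot>\<^sub>m (0\<^sub>m n n :: complex mat)" by (intro eq_matI) auto
    then show ?case using smult[of "0\<^sub>m n n" 0] by simp
  next
    case (insert p I)
    have "mat n n (\<lambda>q. if q \<in> insert p I then X $$ q else 0) =
        X $$ p \<cdot>\<^sub>m mat n n (\<lambda>q. of_bool (q = p)) + mat n n (\<lambda>q. if q \<in> I then X $$ q else 0)"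
      using insert.hyps by (intro eq_matI) auto
    then show ?case using insert by (simp add: add smult)
  qed
  from this[of "{..<n} \<times> {..<n}"]
  have "g (mat n n (\<lambda>p. if p \<in> {..<n} \<times> {..<n} then X $$ p else 0)) =
      (\<Sum>p \<in> {..<n} \<times> {..<n}. X $$ p * g (mat n n (\<lambda>q. of_bool (q = p))))" by simp
  moreover have "mat n n (\<lambda>p. if p \<in> {..<n} \<times> {..<n} then X $$ p else 0) = X"
    using X by (intro eq_matI) auto
  ultimately show ?thesis by (simp add: case_prod_unfold)
qed

text \<open>Existence of the adjoint: the functional \<open>g\<close> is represented by a matrix
  \<open>Z\<close>, which \<open>map_adjoint\<close> must then return.\<close>

lemma mat_trace_map_adjoint:
  assumes f: "f \<in> linear_maps n m" and Y: "Y \<in> carrier_mat m m" and X: "X \<in> carrier_mat n n"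
  shows "mat_trace (map_adjoint n m f Y * X) = mat_trace (Y * f X)"
proof -
  define g where "g X = mat_trace (Y * f X)" for X
  \<comment> \<open>The indices are swapped because \<open>tr (Z U)\<close>, for the matrix unit
    \<open>U\<close> with its one at \<open>(j, i)\<close>, is entry \<open>(i, j)\<close> of
    \<open>Z\<close>.\<close>
  define Z where "Z = mat n n (\<lambda>(i, j). g (mat n n (\<lambda>p. of_bool (p = (j, i)))))"
  have carr: "\<And>X. X \<in> carrier_mat n n \<Longrightarrow> f X \<in> carrier_mat m m"
    using f by (simp add: linear_maps_iff)
  have Z: "Z \<in> carrier_mat n n" by (simp add: Z_def)
  have gZ: "g X = mat_trace (Z * X)" if "X \<in> carrier_mat n n" for X
  proof -
    have "g X = (\<Sum>(i, j) \<in> {..<n} \<times> {..<n}. X $$ (i, j) * g (mat n n (\<lambda>p. of_bool (p = (i, j)))))"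
      by (rule linear_functional_expansion[OF _ _ that])
        (use f carr Y in \<open>simp_all add: g_def linear_maps_iff mult_add_distrib_mat[of _ m m _ m]
          mult_smult_distrib[of _ m m _ m] mat_trace_add[of _ m] mat_trace_smult[of _ m]\<close>)
    also have "\<dots> = (\<Sum>i<n. \<Sum>j<n. X $$ (i, j) * Z $$ (j, i))"
      unfolding sum.cartesian_product by (intro sum.cong) (auto simp: Z_def)
    also have "\<dots> = mat_trace (X * Z)"
      using that by (subst mat_trace_mult[of _ n n]) (auto simp: Z_def)
    also have "\<dots> = mat_trace (Z * X)"
      using that by (intro mat_trace_comm[of _ n n]) (auto simp: Z_def)
    finally show ?thesis .
  qed
  have "map_adjoint n m f Y = Z"
    by (rule map_adjoint_eqI[OF Z]) (simp add: gZ flip: g_def)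
  then show ?thesis by (simp add: gZ[OF X] flip: g_def)
qed

section \<open>Subalgebras of correctable algebras\<close>

text \<open>Dimension equations can be settled by rewriting, with no intermediate size to guess, so
  long products rebracket automatically.\<close>

lemma assoc_mult_mat_dim:
  fixes A B C :: "complex mat"
  assumes "dim_col A = dim_row B" and "dim_col B = dim_row C"
  shows "A * B * C = A * (B * C)"
  by (rule assoc_mult_mat[of _ "dim_row A" "dim_col A" _ "dim_col B" _ "dim_col C"])
    (use assms in \<open>auto intro: carrier_matI\<close>)

lemma mat_adjoint_mult_dim:
  fixes A B :: "complex mat"
  assumes "dim_col A = dim_row B"
  shows "mat_adjoint (A * B) = mat_adjoint B * mat_adjoint A"
  by (rule mat_adjoint_mult[of _ "dim_row A" "dim_col A" _ "dim_col B"])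
    (use assms in \<open>auto intro: carrier_matI\<close>)

lemma mat_trace_comm_dim:
  assumes "dim_col A = dim_row B" and "dim_col B = dim_row A"
  shows "mat_trace (A * B) = mat_trace (B * A)"
  by (rule mat_trace_comm[of _ "dim_row A" "dim_col A"])
    (use assms in \<open>auto intro: carrier_matI\<close>)

text \<open>The pure state prepared with the weight that a compression loses.\<close>

definition first_state :: "nat \<Rightarrow> complex mat" where
  "first_state l = mat l l (\<lambda>rs. of_bool (rs = (0, 0)))"

lemma mat_trace_first_state: "0 < l \<Longrightarrow> mat_trace (first_state l) = 1"
  by (simp add: mat_trace_def first_state_def sum.If_cases of_bool_def)

text \<open>Compression by a coisometry \<open>K\<close>, made trace preserving by preparing a fixed state on the
  complement; the Kraus operators of the second term are \<open>|0\<rangle>\<langle>j| L\<close>.\<close>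

lemma quantum_channel_compression:
  assumes K: "K \<in> carrier_mat l k" and KK: "K * mat_adjoint K = 1\<^sub>m l" and l: "0 < l"
    and L: "L = 1\<^sub>m k - mat_adjoint K * K"
  obtains E where "quantum_channel k l E"
    and "\<And>Y. Y \<in> carrier_mat k k \<Longrightarrow>
      E Y = K * Y * mat_adjoint K + mat_trace (L * Y) \<cdot>\<^sub>m first_state l"
proof -
  have [simp]: "dim_row K = l" "dim_col K = k" using K by auto
  have Lc: "L \<in> carrier_mat k k" by (simp add: L minus_carrier_mat[OF mult_carrier_mat[of _ k l]] K)
  then have [simp]: "dim_row L = k" "dim_col L = k" by auto
  \<comment> \<open>\<open>N\<close> projects onto the initial space of \<open>K\<close>, and
    \<open>L\<close> onto its complement.\<close>
  define N where "N = mat_adjoint K * K"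
  have N: "N \<in> carrier_mat k k" unfolding N_def by (intro mult_carrier_mat[of _ k l]) (simp_all add: K)
  have "N * N = mat_adjoint K * (K * mat_adjoint K * K)"
    by (simp add: N_def assoc_mult_mat_dim)
  then have NN: "N * N = N" using K by (simp add: KK N_def)
  have adjL: "mat_adjoint L = L"
    using N unfolding L N_def[symmetric]
    by (simp add: mat_adjoint_minus[of _ k k]) (simp add: N_def mat_adjoint_mult_dim)
  have LL: "L * L = L"
    using projection_diff[of "1\<^sub>m k" k N] N NN unfolding L N_def[symmetric] by simp
  \<comment> \<open>Index 0 is the compression; index \<open>j + 1\<close> carries row
    \<open>j\<close> of \<open>L\<close> as its first row, hence the shift \<open>j - 1\<close> and
    the count \<open>Suc k\<close>.\<close>
  define R where "R j = (if j = 0 then K else mat l k (\<lambda>(i, p). if i = 0 then L $$ (j - 1, p) else 0))" for j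
  have R: "R j \<in> carrier_mat l k" for j using K by (simp add: R_def)
  let ?E = "kraus_map l (Suc k) R"
  have E: "?E Y = K * Y * mat_adjoint K + mat_trace (L * Y) \<cdot>\<^sub>m first_state l"
    if Y: "Y \<in> carrier_mat k k" for Y
  proof (rule eq_matI)
    have [simp]: "dim_row Y = k" "dim_col Y = k" using Y by auto
    fix r s assume "r < dim_row (K * Y * mat_adjoint K + mat_trace (L * Y) \<cdot>\<^sub>m first_state l)"
      and "s < dim_col (K * Y * mat_adjoint K + mat_trace (L * Y) \<cdot>\<^sub>m first_state l)"
    then have rs: "r < l" "s < l" by (simp_all add: first_state_def)
    \<comment> \<open>An operator with only a first row contributes only at \<open>(0, 0)\<close>;
      the contributions are the diagonal of \<open>L Y L\<close> and sum to its trace.\<close>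
    have prep: "(R (Suc j) * Y * mat_adjoint (R (Suc j))) $$ (r, s) =
        (if r = 0 \<and> s = 0 then (L * Y * mat_adjoint L) $$ (j, j) else 0)" if "j < k" for j
      using rs that by (simp add: R_def scalar_prod_def)
    have "(\<Sum>j<k. (L * Y * mat_adjoint L) $$ (j, j)) = mat_trace (L * Y * L)"
      by (simp add: mat_trace_def adjL)
    also have "\<dots> = mat_trace (L * (L * Y))"
      by (rule mat_trace_comm_dim) simp_all
    also have "\<dots> = mat_trace (L * Y)"
      by (simp add: LL flip: assoc_mult_mat_dim)
    finally have tr: "(\<Sum>j<k. (L * Y * mat_adjoint L) $$ (j, j)) = mat_trace (L * Y)" .
    have "?E Y $$ (r, s) = (R 0 * Y * mat_adjoint (R 0)) $$ (r, s) +
        (\<Sum>j<k. (R (Suc j) * Y * mat_adjoint (R (Suc j))) $$ (r, s))"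
      using rs by (simp add: kraus_map_def sum.lessThan_Suc_shift del: sum.lessThan_Suc)
    also have "\<dots> = (K * Y * mat_adjoint K) $$ (r, s) +
        (if r = 0 \<and> s = 0 then mat_trace (L * Y) else 0)"
      by (simp add: prep tr[symmetric]) (simp add: R_def)
    finally show "?E Y $$ (r, s) =
        (K * Y * mat_adjoint K + mat_trace (L * Y) \<cdot>\<^sub>m first_state l) $$ (r, s)"
      using rs by (simp add: first_state_def)
  qed (simp_all add: kraus_map_def first_state_def)
  have "mat_trace (?E Y) = mat_trace Y" if Y: "Y \<in> carrier_mat k k" for Y
  proof -
    have [simp]: "dim_row Y = k" "dim_col Y = k" using Y by auto
    \<comment> \<open>The trace kept is \<open>tr (N Y)\<close>, the trace prepared is
      \<open>tr (L Y)\<close>, and \<open>L + N = 1\<close>.\<close>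
    have "mat_trace (?E Y) = mat_trace (K * Y * mat_adjoint K) + mat_trace (L * Y)"
      unfolding E[OF Y]
      by (subst mat_trace_add[of _ l]) (use l in \<open>auto simp: first_state_def[abs_def] mat_trace_smult[of _ l]
          mat_trace_first_state[unfolded first_state_def] intro!: carrier_matI\<close>)
    also have "mat_trace (K * Y * mat_adjoint K) = mat_trace (mat_adjoint K * (K * Y))"
      by (rule mat_trace_comm_dim) simp_all
    also have "mat_adjoint K * (K * Y) = N * Y"
      by (simp add: N_def assoc_mult_mat_dim)
    also have "L * Y = Y - N * Y"
      using N Y unfolding L N_def[symmetric] by (subst minus_mult_distrib_mat[of _ k k]) simp_all
    also have "mat_trace (Y - N * Y) = mat_trace Y - mat_trace (N * Y)"
      using N Y by (intro mat_trace_minus[of _ k]) simp_all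
    finally show ?thesis by simp
  qed
  then have "quantum_channel k l ?E"
    using R by (simp add: quantum_channel_def linear_maps_kraus_map completely_positive_kraus_map)
  then show ?thesis using E by (rule that)
qed

lemma unit_projectionD:
  assumes "unit_projection n S P"
  shows "P \<in> S" and "P * P = P" and "mat_adjoint P = P"
    and "X \<in> S \<Longrightarrow> P * X = X" and "X \<in> S \<Longrightarrow> X * P = X"
  using assms by (simp_all add: unit_projection_def)

lemma mat_subspace_star_subalgebra:
  "star_subalgebra n S \<Longrightarrow> mat_subspace n S"
  by (auto simp: star_subalgebra_def LinearCombinations.submodule_def mat_subspace_def op_algebra_simps)

text \<open>If \<open>D\<close> decodes \<open>S\<close> and \<open>K = W* V\<close> compresses the range of \<open>P\<close> to that of \<open>Q\<close>, then the
  compression of \<open>D\<close> decodes \<open>T\<close>. The trace correction does not contribute, since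
  \<open>1 - K* K = V* (P - Q) V\<close> is decoded correctly and vanishes on the range of \<open>Q\<close>.\<close>

lemma correctable_subalgebra:
  assumes \<Phi>: "\<Phi> \<in> linear_maps n m" and S: "correctable n m \<Phi> S"
    and T: "star_subalgebra n T" "T \<subseteq> S" "T \<noteq> {0\<^sub>m n n}" and Q: "unit_projection n T Q"
  shows "correctable n m \<Phi> T"
proof -
  obtain P k V D where P: "unit_projection n S P" and V: "subspace_inclusion n k P V"
    and D: "quantum_channel m k D"
    and dec: "\<And>Y. Y \<in> S \<Longrightarrow> map_adjoint k k (D \<circ> restrict_map V \<Phi>) (mat_adjoint V * Y * V)
        = mat_adjoint V * Y * V"
    using S unfolding correctable_def by blast
  have Ssub: "mat_subspace n S" and Tsub: "mat_subspace n T"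
    using S T(1) by (auto simp: correctable_def mat_subspace_star_subalgebra)
  have carr: "\<And>X. X \<in> S \<Longrightarrow> X \<in> carrier_mat n n" using Ssub unfolding mat_subspace_def by blast
  have QS: "Q \<in> S" using unit_projectionD(1)[OF Q] T(2) by blast
  note Pc = carr[OF unit_projectionD(1)[OF P]] and Qc = carr[OF QS]
  obtain l W where W: "subspace_inclusion n l Q W"
    using subspace_inclusion_exists[OF Qc] unit_projectionD(2,3)[OF Q] by blast
  have Vc: "V \<in> carrier_mat n k" and VV: "mat_adjoint V * V = 1\<^sub>m k" and VP: "V * mat_adjoint V = P"
    using V by (simp_all add: subspace_inclusion_def)
  have Wc: "W \<in> carrier_mat n l" and WW: "mat_adjoint W * W = 1\<^sub>m l" and WQ: "W * mat_adjoint W = Q"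
    using W by (simp_all add: subspace_inclusion_def)
  have [simp]: "dim_row V = n" "dim_col V = k" "dim_row W = n" "dim_col W = l"
    "dim_row P = n" "dim_col P = n" "dim_row Q = n" "dim_col Q = n"
    using Vc Wc Pc Qc by auto
  have PQ: "P * Q = Q" "Q * P = Q" using unit_projectionD(4,5)[OF P] QS by auto
  have QW: "Q * W = W"
    using Wc by (simp add: WQ[symmetric] assoc_mult_mat_dim WW)
  have PW: "P * W = W"
  proof -
    have "P * (Q * W) = P * Q * W" by (simp add: assoc_mult_mat_dim)
    then show ?thesis by (simp add: PQ QW)
  qed
  \<comment> \<open>A zero range would force \<open>Q = 0\<close> and \<open>T = {0}\<close>,
    leaving no space on which to prepare a state.\<close>
  have l: "0 < l"
  proof (rule ccontr)
    assume "\<not> 0 < l"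
    then have "Q = 0\<^sub>m n n" unfolding WQ[symmetric] by (intro eq_matI) (auto simp: scalar_prod_def)
    then have "X = 0\<^sub>m n n" if "X \<in> T" for X
      using unit_projectionD(4)[OF Q that] carr[of X] T(2) that by auto
    then show False using T(3) Tsub unfolding mat_subspace_def by blast
  qed
  define K where "K = mat_adjoint W * V"
  have adjK: "mat_adjoint K = mat_adjoint V * W" by (simp add: K_def mat_adjoint_mult_dim)
  have Kc: "K \<in> carrier_mat l k" unfolding K_def by (intro carrier_matI) simp_all
  have [simp]: "dim_row K = l" "dim_col K = k" using Kc by auto
  \<comment> \<open>The range of \<open>Q\<close> lies inside that of \<open>P\<close>, so including
    it by way of the range of \<open>P\<close> loses nothing.\<close>
  have VK: "V * mat_adjoint K = W"
  proof -
    have "V * mat_adjoint K = V * mat_adjoint V * W" by (simp add: adjK assoc_mult_mat_dim)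
    then show ?thesis by (simp add: VP PW)
  qed
  have KV: "K * mat_adjoint V = mat_adjoint W"
    using arg_cong[OF VK, of mat_adjoint] by (simp add: mat_adjoint_mult_dim)
  have "K * mat_adjoint K = mat_adjoint W * V * mat_adjoint K" by (simp only: K_def)
  then have KK: "K * mat_adjoint K = 1\<^sub>m l"
    by (simp add: assoc_mult_mat_dim VK WW)
  define L where "L = 1\<^sub>m k - mat_adjoint K * K"
  obtain E where E: "quantum_channel k l E"
    and E_eq: "\<And>Y. Y \<in> carrier_mat k k \<Longrightarrow>
      E Y = K * Y * mat_adjoint K + mat_trace (L * Y) \<cdot>\<^sub>m first_state l"
    using quantum_channel_compression[OF Kc KK l L_def] by blast
  have Dlin: "D \<in> linear_maps m k" using D by (simp add: quantum_channel_def)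
  have lin: "D \<circ> restrict_map V \<Phi> \<in> linear_maps k k"
    using linear_maps_comp[OF linear_maps_comp[OF linear_maps_conj[OF Vc] \<Phi>] Dlin]
    by (simp add: restrict_map_def[abs_def] comp_def)
  \<comment> \<open>The decoding condition, read as preservation of expectation values.\<close>
  have dec_tr: "mat_trace (mat_adjoint V * Z * V * D (restrict_map V \<Phi> Y)) =
      mat_trace (mat_adjoint V * Z * V * Y)" if "Z \<in> S" "Y \<in> carrier_mat k k" for Z Y
  proof -
    have "mat_adjoint V * Z * V \<in> carrier_mat k k"
      using carr[OF that(1)] by (intro carrier_matI) simp_all
    from mat_trace_map_adjoint[OF lin this that(2)] dec[OF that(1)] show ?thesis by simp
  qed
  \<comment> \<open>\<open>V* P V = 1\<close> and \<open>V* Q V = K* K\<close>, so the lost weight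
    is measured by an element of the compressed large algebra.\<close>
  have Ld: "L = mat_adjoint V * (P - Q) * V"
  proof -
    have "mat_adjoint V * (P - Q) * V = mat_adjoint V * P * V - mat_adjoint V * Q * V"
      using Vc Pc Qc by (simp add: mult_minus_distrib_mat[of _ k n _ n] minus_mult_distrib_mat[of _ k n _ _ k]
          mult_carrier_mat[of _ k n])
    also have "mat_adjoint V * P * V = (mat_adjoint V * V) * (mat_adjoint V * V)"
      by (simp add: assoc_mult_mat_dim flip: VP)
    also have "\<dots> = 1\<^sub>m k" by (simp add: VV)
    also have "mat_adjoint V * Q * V = mat_adjoint K * K"
      unfolding adjK by (simp add: assoc_mult_mat_dim K_def flip: WQ)
    finally show ?thesis by (simp add: L_def)
  qed
  have PQS: "P - Q \<in> S"
    by (rule mat_subspace_minus[OF Ssub unit_projectionD(1)[OF P] QS])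
  have LK: "L * mat_adjoint K = 0\<^sub>m k l"
  proof -
    have "L * mat_adjoint K = mat_adjoint K - mat_adjoint K * K * mat_adjoint K"
      unfolding L_def using Kc by (subst minus_mult_distrib_mat[of _ k k]) (auto intro: carrier_matI)
    also have "mat_adjoint K * K * mat_adjoint K = mat_adjoint K"
      using Kc by (simp add: assoc_mult_mat_dim KK)
    finally show ?thesis using Kc by simp
  qed
  have "map_adjoint l l ((E \<circ> D) \<circ> restrict_map W \<Phi>) (mat_adjoint W * Z * W) = mat_adjoint W * Z * W"
    if Z: "Z \<in> T" for Z
  proof (rule map_adjoint_eqI)
    let ?X = "mat_adjoint W * Z * W"
    have ZS: "Z \<in> S" using Z T(2) by blast
    have [simp]: "dim_row Z = n" "dim_col Z = n" using carr[OF ZS] by auto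
    show "?X \<in> carrier_mat l l" by (intro carrier_matI) simp_all
    fix Y :: "complex mat" assume Y: "Y \<in> carrier_mat l l"
    have [simp]: "dim_row Y = l" "dim_col Y = l" using Y by auto
    \<comment> \<open>\<open>Y'\<close> is the input \<open>Y\<close> placed in the range of
      \<open>P\<close>; both restricted maps then give the same output of
      \<open>\<Phi>\<close>.\<close>
    define Y' where "Y' = mat_adjoint K * Y * K"
    have Y': "Y' \<in> carrier_mat k k" unfolding Y'_def by (intro carrier_matI) simp_all
    have [simp]: "dim_row Y' = k" "dim_col Y' = k" using Y' by auto
    have "V * Y' * mat_adjoint V = (V * mat_adjoint K) * Y * (K * mat_adjoint V)"
      by (simp add: Y'_def assoc_mult_mat_dim)
    then have restr: "restrict_map W \<Phi> Y = restrict_map V \<Phi> Y'"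
      by (simp add: restrict_map_def VK KV)
    define A where "A = D (restrict_map V \<Phi> Y')"
    have A: "A \<in> carrier_mat k k" using lin Y' by (simp add: linear_maps_iff A_def)
    have [simp]: "dim_row A = k" "dim_col A = k" using A by auto
    have "mat_trace (L * A) = mat_trace (L * Y')"
      unfolding Ld A_def by (rule dec_tr[OF PQS Y'])
    also have "L * Y' = L * mat_adjoint K * (Y * K)"
      by (simp add: Y'_def assoc_mult_mat_dim Ld carr[OF PQS, THEN carrier_matD(1)] carr[OF PQS, THEN carrier_matD(2)])
    also have "\<dots> = 0\<^sub>m k k"
      unfolding LK by (rule left_mult_zero_mat[of _ l k]) (auto intro: carrier_matI)
    finally have trL: "mat_trace (L * A) = 0" by simp
    have "Z = Q * Z * Q" using unit_projectionD(4,5)[OF Q Z] by simp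
    also have "\<dots> = W * ?X * mat_adjoint W" by (simp add: assoc_mult_mat_dim flip: WQ)
    finally have ZX: "Z = W * ?X * mat_adjoint W" .
    \<comment> \<open>In the Heisenberg picture the compression takes \<open>W* Z W\<close> back to
      \<open>V* Z V\<close>, which \<open>D\<close> is known to decode.\<close>
    have KXK: "mat_adjoint K * ?X * K = mat_adjoint V * Z * V"
    proof -
      have "mat_adjoint K * ?X * K = mat_adjoint V * W * ?X * (mat_adjoint W * V)"
        by (simp only: adjK) (simp only: K_def)
      also have "\<dots> = mat_adjoint V * (W * ?X * mat_adjoint W) * V"
        by (simp add: assoc_mult_mat_dim)
      finally show ?thesis unfolding ZX[symmetric] .
    qed
    have "mat_trace (?X * (E \<circ> D \<circ> restrict_map W \<Phi>) Y) = mat_trace (?X * (K * A * mat_adjoint K))"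
    proof -
      have "(E \<circ> D \<circ> restrict_map W \<Phi>) Y = K * A * mat_adjoint K + 0 \<cdot>\<^sub>m first_state l"
        by (simp add: restr E_eq[OF A] trL flip: A_def)
      also have "\<dots> = K * A * mat_adjoint K"
        by (intro eq_matI) (auto simp: first_state_def)
      finally show ?thesis by simp
    qed
    also have "?X * (K * A * mat_adjoint K) = (?X * K * A) * mat_adjoint K"
      by (simp add: assoc_mult_mat_dim)
    also have "mat_trace \<dots> = mat_trace (mat_adjoint K * (?X * K * A))"
      by (rule mat_trace_comm_dim) simp_all
    also have "mat_adjoint K * (?X * K * A) = mat_adjoint K * ?X * K * A"
      by (simp add: assoc_mult_mat_dim)
    also have "mat_trace \<dots> = mat_trace (mat_adjoint V * Z * V * Y')"
      unfolding KXK A_def by (rule dec_tr[OF ZS Y'])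
    \<comment> \<open>Expanding both factors exposes \<open>K K* = 1\<close> once; cyclicity of the
      trace exposes it again.\<close>
    also have "mat_adjoint V * Z * V * Y' = mat_adjoint K * (?X * (K * mat_adjoint K) * Y * K)"
      unfolding KXK[symmetric] Y'_def by (simp add: assoc_mult_mat_dim)
    also have "\<dots> = mat_adjoint K * (?X * Y * K)"
      unfolding KK by (simp add: right_mult_one_mat[of _ l l] carrier_matI)
    also have "mat_trace \<dots> = mat_trace (?X * Y * K * mat_adjoint K)"
      by (rule mat_trace_comm_dim) simp_all
    also have "?X * Y * K * mat_adjoint K = ?X * Y * (K * mat_adjoint K)"
      by (simp add: assoc_mult_mat_dim)
    also have "\<dots> = ?X * Y"
      unfolding KK by (rule right_mult_one_mat[of _ l l]) (auto intro: carrier_matI)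
    finally show "mat_trace (?X * (E \<circ> D \<circ> restrict_map W \<Phi>) Y) = mat_trace (?X * Y)" .
  qed
  then show ?thesis
    using T(1) Q W quantum_channel_comp[OF D E] unfolding correctable_def by blast
qed

text \<open>Supplies what the matrix argument asks for: finite dimension gives finitely many
  generators of the image, hence a unit projection, and injectivity keeps the image nonzero.\<close>

lemma correctable_image:
  assumes C: "fd_cstar_algebra C" and nonzero: "nonzero_alg C"
    and f: "f \<in> star_hom C (op_algebra n)" and inj: "inj_on f (carrier C)"
    and \<Phi>: "\<Phi> \<in> linear_maps n m" and S: "correctable n m \<Phi> S" and sub: "f ` carrier C \<subseteq> S"
  shows "correctable n m \<Phi> (f ` carrier C)"
proof -
  interpret C: fd_cstar_algebra C by (rule C)
  interpret f: linear_map class_ring C "op_algebra n" f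
    by (rule C.linear_map_star_hom[OF op_algebra_vectorspace f])
  have star: "star_subalgebra n (f ` carrier C)"
    using f.im_is_submodule star_homD(4,5)[OF f, symmetric] C.alg_mult_closed C.star_closed
    by (auto simp: star_subalgebra_def f.im_def op_algebra_simps)
  obtain G where G: "finite G" "G \<subseteq> carrier C" "C.span G = carrier C"
    using C.finite_dimensional unfolding C.fin_dim_def by blast
  have gen: "f ` carrier C \<subseteq> T" if T: "mat_subspace n T" "f ` G \<subseteq> T" for T
  proof -
    \<comment> \<open>The preimage of \<open>T\<close> is a submodule containing \<open>G\<close>,
      hence all of \<open>C\<close>.\<close>
    have "LinearCombinations.submodule class_ring {x \<in> carrier C. f x \<in> T} C"
      using T(1) C.module_axioms
      by (auto simp: LinearCombinations.submodule_def mat_subspace_def op_algebra_simps star_homD[OF f]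
          C.alg_smult_closed f.f0_is_0)
    then have "C.span G \<subseteq> {x \<in> carrier C. f x \<in> T}"
      by (rule C.span_is_subset[rotated]) (use G(2) T(2) in auto)
    then show ?thesis using G(3) by auto
  qed
  obtain Q where Q: "unit_projection n (f ` carrier C) Q"
    by (rule unit_projection_exists[OF mat_subspace_star_subalgebra[OF star], of "f ` G"])
      (use star G gen in \<open>auto simp: star_subalgebra_def\<close>)
  have "f ` carrier C \<noteq> {0\<^sub>m n n}"
  proof
    assume *: "f ` carrier C = {0\<^sub>m n n}"
    have "x = \<zero>\<^bsub>C\<^esub>" if "x \<in> carrier C" for x
    proof (rule inj_onD[OF inj _ that C.zero_closed])
      have "f x = 0\<^sub>m n n" using * that by blast
      then show "f x = f \<zero>\<^bsub>C\<^esub>" by (simp add: op_algebra_simps)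
    qed
    then show False using nonzero C.zero_closed unfolding nonzero_alg_def by blast
  qed
  then show ?thesis by (rule correctable_subalgebra[OF \<Phi> S star sub _ Q])
qed

text \<open>The composite embedding maps \<open>C\<close> into the correctable image of
  \<open>B\<close>. Isomorphisms are embeddings, so transmittability also passes between isomorphic
  copies.\<close>

lemma transmittable_embeds:
  assumes "fd_cstar_algebra C" and "nonzero_alg C" and "\<Phi> \<in> linear_maps n m"
    and emb: "embeds C B" and B: "transmittable n m \<Phi> B"
  shows "transmittable n m \<Phi> C"
proof -
  obtain g where g: "g \<in> star_hom C B" "inj_on g (carrier C)"
    using emb unfolding embeds_def by blast
  obtain \<pi> where \<pi>: "\<pi> \<in> star_hom B (op_algebra n)" "inj_on \<pi> (carrier B)"
    and S: "correctable n m \<Phi> (\<pi> ` carrier B)"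
    using B unfolding transmittable_def by blast
  have sub: "g ` carrier C \<subseteq> carrier B" using star_homD(1)[OF g(1)] by blast
  have hom: "\<pi> \<circ> g \<in> star_hom C (op_algebra n)" by (rule star_hom_comp[OF g(1) \<pi>(1)])
  have inj: "inj_on (\<pi> \<circ> g) (carrier C)"
    using g(2) inj_on_subset[OF \<pi>(2) sub] by (rule comp_inj_on)
  have "correctable n m \<Phi> ((\<pi> \<circ> g) ` carrier C)"
    using assms(1-3) by (rule correctable_image[OF _ _ hom inj _ S]) (use sub in auto)
  then show ?thesis using hom inj unfolding transmittable_def by blast
qed

theorem theorem4p11:
  fixes n m :: nat
    and \<Phi> :: "complex mat \<Rightarrow> complex mat"
    and A :: "'a cstar"
  assumes "quantum_channel n m \<Phi>"
    and "fd_cstar_algebra A"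
    and "nonzero_alg A"
  shows "(\<exists>D. dominating_transmittable n m \<Phi> D \<and> star_isomorphic D A) \<longleftrightarrow>
    (A \<in> transmittable_algebras n m \<Phi> \<and>
     forbidden_types A \<inter> transmittable_algebras n m \<Phi> = {})"
proof
  have \<Phi>: "\<Phi> \<in> linear_maps n m" using assms(1) by (simp add: quantum_channel_def)
  {
    assume "\<exists>D. dominating_transmittable n m \<Phi> D \<and> star_isomorphic D A"
    then obtain D where "dominating_transmittable n m \<Phi> D" and iso: "star_isomorphic D A"
      by blast
    then have D: "D \<in> transmittable_algebras n m \<Phi>"
      and dom: "\<And>B :: complex mat cstar. B \<in> transmittable_algebras n m \<Phi> \<Longrightarrow> embeds B D"
      by (simp_all add: dominating_transmittable_def)
    have "fd_cstar_algebra D" using D by (simp add: transmittable_algebras_def)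
    from fd_cstar_algebra.star_isomorphic_sym[OF this iso]
    have emb: "embeds A D" by (rule star_isomorphic_embeds)
    have "transmittable n m \<Phi> D" using D by (simp add: transmittable_algebras_def)
    from transmittable_embeds[OF assms(2,3) \<Phi> emb this]
    have "A \<in> transmittable_algebras n m \<Phi>"
      using assms(2,3) by (simp add: transmittable_algebras_def)
    \<comment> \<open>Whatever is transmittable embeds into \<open>D\<close> and so into
      \<open>A\<close>, which rules out every forbidden type.\<close>
    moreover have "embeds B A" if "B \<in> transmittable_algebras n m \<Phi>" for B :: "complex mat cstar"
      by (rule embeds_trans[OF dom[OF that] star_isomorphic_embeds[OF iso]])
    ultimately show "A \<in> transmittable_algebras n m \<Phi> \<and>
        forbidden_types A \<inter> transmittable_algebras n m \<Phi> = {}"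
      unfolding forbidden_types_def by blast
  next
    assume R: "A \<in> transmittable_algebras n m \<Phi> \<and>
        forbidden_types A \<inter> transmittable_algebras n m \<Phi> = {}"
    then have trA: "transmittable n m \<Phi> A" by (simp add: transmittable_algebras_def)
    then obtain \<pi> where "\<pi> \<in> star_hom A (op_algebra n)" "inj_on \<pi> (carrier A)"
      unfolding transmittable_def by blast
    from star_isomorphic_image[OF assms(2) this]
    obtain D :: "complex mat cstar" where D: "fd_cstar_algebra D" and iso: "star_isomorphic A D" by blast
    have iso': "star_isomorphic D A" by (rule fd_cstar_algebra.star_isomorphic_sym[OF assms(2) iso])
    have nonzero: "nonzero_alg D"
    proof -
      obtain h where h: "h \<in> star_hom D A" "bij_betw h (carrier D) (carrier A)"
        using iso' unfolding star_isomorphic_def by blast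
      interpret A: fd_cstar_algebra A by (rule assms(2))
      interpret D: fd_cstar_algebra D by (rule D)
      interpret h: linear_map class_ring D A h
        by (rule D.linear_map_star_hom[OF A.vectorspace_axioms h(1)])
      have "carrier A = {\<zero>\<^bsub>A\<^esub>}" if "carrier D = {\<zero>\<^bsub>D\<^esub>}"
        using h(2) h.f0_is_0 that by (simp add: bij_betw_def)
      then show ?thesis using assms(3) unfolding nonzero_alg_def by blast
    qed
    have DT: "D \<in> transmittable_algebras n m \<Phi>"
      using transmittable_embeds[OF D nonzero \<Phi> star_isomorphic_embeds[OF iso'] trA] D nonzero
      by (simp add: transmittable_algebras_def)
    have "embeds B A" if B: "B \<in> transmittable_algebras n m \<Phi>" for B :: "complex mat cstar"
    proof (rule ccontr)
      assume "\<not> embeds B A"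
      with B obtain C where C: "C \<in> forbidden_types A" "embeds C B"
        using forbidden_type_below[of B A] by (auto simp: transmittable_algebras_def)
      then have "C \<in> transmittable_algebras n m \<Phi>"
        using transmittable_embeds[OF _ _ \<Phi>, of C B] B
        by (auto simp: transmittable_algebras_def forbidden_types_def)
      then show False using C R by blast
    qed
    then have "embeds B D" if "B \<in> transmittable_algebras n m \<Phi>" for B :: "complex mat cstar"
      using that embeds_trans star_isomorphic_embeds[OF iso] by blast
    then show "\<exists>D. dominating_transmittable n m \<Phi> D \<and> star_isomorphic D A"
      using DT iso' unfolding dominating_transmittable_def by blast
  }
qed

end
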